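(* Let $H$ be a finite connected simple non-bipartite graph of maximum degree at most $3$ and minimum degree $2$. If $H$ has no adjacency eigenvalue in $(-1,1)$, then $H$ is isomorphic to $K_3$ or to $\mathsf{HJ}_n'$ for some $n\ge1$.
   Context: The twisted ladder $T_n$ ($n\ge1$) has vertices $x_i, x_i', y_i, y_i'$ ($1\le i\le n$) and edges $x_iy_i, x_iy_i', x_i'y_i, x_i'y_i'$ for $1\le i\le n$ and $y_ix_{i+1}, y_i'x_{i+1}'$ for $1\le i\le n-1$. $\mathsf{HJ}_n'$ is obtained from $T_n$ by adding three new vertices $p,q,r$ and edges $x_1p,pq,qr,rx_1'$, together with the edge $y_ny_n'$. *)

theory Defs
  imports
    Complex_Main
    "Graph_Theory.Graph_Theory"
    "Jordan_Normal_Form.Char_Poly"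
begin

text \<open>
  A finite simple graph is a symmetric loop-free finite digraph given by its vertex set and
  its set of ordered pairs of adjacent vertices (locale \<^locale>\<open>pair_graph\<close>); every edge
  contributes both of its orientations, so \<^const>\<open>out_degree\<close> is the degree.
\<close>

definition max_degree :: "'a pair_pre_digraph \<Rightarrow> nat" where
  "max_degree G = Max (out_degree (with_proj G) ` pverts G)"

definition min_degree :: "'a pair_pre_digraph \<Rightarrow> nat" where
  "min_degree G = Min (out_degree (with_proj G) ` pverts G)"

definition bipartite :: "'a pair_pre_digraph \<Rightarrow> bool" where
  "bipartite G \<longleftrightarrow> (\<exists>U V. pverts G = U \<union> V \<and> U \<inter> V = {} \<and> parcs G \<subseteq> U \<times> V \<union> V \<times> U)"

definition adjacency_matrix :: "'a pair_pre_digraph \<Rightarrow> 'a list \<Rightarrow> real mat" where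
  "adjacency_matrix G vs =
     mat (length vs) (length vs) (\<lambda>(i, j). if (vs ! i, vs ! j) \<in> parcs G then 1 else 0)"

text \<open>
  The matrix depends on an enumeration of the vertices, its eigenvalues do not
  (see \<open>adjacency_eigenvalue_iff\<close>). Adjacency matrices are symmetric, so all their complex
  eigenvalues are real and nothing is lost by working over the reals.
\<close>

definition adjacency_eigenvalue :: "'a pair_pre_digraph \<Rightarrow> real \<Rightarrow> bool" where
  "adjacency_eigenvalue G k \<longleftrightarrow>
     (\<exists>vs. distinct vs \<and> set vs = pverts G \<and> eigenvalue (adjacency_matrix G vs) k)"

lemma eigenvalue_adjacency_matrix_iff:
  assumes "distinct vs" "set vs = pverts G"
  shows "eigenvalue (adjacency_matrix G vs) k \<longleftrightarrow>
    (\<exists>f. (\<exists>v\<in>pverts G. f v \<noteq> 0) \<and>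
         (\<forall>u\<in>pverts G. (\<Sum>v | v \<in> pverts G \<and> (u, v) \<in> parcs G. f v) = k * f u))"
    (is "?L \<longleftrightarrow> ?R")
proof -
  let ?n = "length vs" and ?A = "adjacency_matrix G vs"
  have fin: "finite (pverts G)" using assms(2) by (metis List.finite_set)
  have bij: "bij_betw (\<lambda>i. vs ! i) {0..<?n} (pverts G)"
    using bij_betw_nth[OF assms(1), of "{..<?n}" "pverts G"] assms(2)
    by (simp add: atLeast0LessThan)
  have row: "(?A *\<^sub>v x) $ i = (\<Sum>v | v \<in> pverts G \<and> (vs ! i, v) \<in> parcs G. f v)"
    if x: "x \<in> carrier_vec ?n" "\<And>j. j < ?n \<Longrightarrow> x $ j = f (vs ! j)" and i: "i < ?n" for x f i
  proof -
    have "(?A *\<^sub>v x) $ i = (\<Sum>j\<in>{0..<?n}. (if (vs ! i, vs ! j) \<in> parcs G then 1 else 0) * f (vs ! j))"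
      using x i by (auto simp: adjacency_matrix_def scalar_prod_def intro!: sum.cong)
    also have "\<dots> = (\<Sum>v\<in>pverts G. (if (vs ! i, v) \<in> parcs G then 1 else 0) * f v)"
      by (rule sum.reindex_bij_betw[OF bij])
    also have "\<dots> = (\<Sum>v | v \<in> pverts G \<and> (vs ! i, v) \<in> parcs G. f v)"
      using fin by (intro sum.mono_neutral_cong_right) (auto split: if_splits)
    finally show ?thesis .
  qed
  have dim: "dim_row ?A = ?n" "dim_col ?A = ?n" by (simp_all add: adjacency_matrix_def)
  show ?thesis
  proof
    assume ?L
    then obtain x where x: "x \<in> carrier_vec ?n" "x \<noteq> 0\<^sub>v ?n" "?A *\<^sub>v x = k \<cdot>\<^sub>v x"
      by (auto simp: eigenvalue_def eigenvector_def dim)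
    define f where "f v = x $ (the_inv_into {0..<?n} (\<lambda>i. vs ! i) v)" for v
    have f: "f (vs ! j) = x $ j" if "j < ?n" for j
      using bij that unfolding f_def by (auto simp: bij_betw_def the_inv_into_f_f)
    have "\<exists>j<?n. x $ j \<noteq> 0"
    proof (rule ccontr)
      assume "\<not> (\<exists>j<?n. x $ j \<noteq> 0)"
      then have "x = 0\<^sub>v ?n" using x(1) by (intro eq_vecI) auto
      with x(2) show False by simp
    qed
    then obtain j where j: "j < ?n" "x $ j \<noteq> 0" by blast
    have "(\<Sum>v | v \<in> pverts G \<and> (u, v) \<in> parcs G. f v) = k * f u" if "u \<in> pverts G" for u
    proof -
      obtain i where i: "i < ?n" "u = vs ! i" using \<open>u \<in> pverts G\<close> assms(2) by (metis in_set_conv_nth)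
      have "(\<Sum>v | v \<in> pverts G \<and> (u, v) \<in> parcs G. f v) = (?A *\<^sub>v x) $ i"
        using row[OF x(1) _ i(1), of f] f i(2) by simp
      also have "\<dots> = (k \<cdot>\<^sub>v x) $ i" by (simp only: x(3))
      also have "\<dots> = k * f u" using x(1) i f[OF i(1)] by simp
      finally show ?thesis .
    qed
    moreover have "vs ! j \<in> pverts G" "f (vs ! j) \<noteq> 0"
      using j(1) assms(2) nth_mem apply blast
      using j f[OF j(1)] by simp
    ultimately show ?R by (intro exI[of _ f] conjI bexI[of _ "vs ! j"] ballI)
  next
    assume ?R
    then obtain f v where f: "v \<in> pverts G" "f v \<noteq> 0"
      "\<And>u. u \<in> pverts G \<Longrightarrow> (\<Sum>v | v \<in> pverts G \<and> (u, v) \<in> parcs G. f v) = k * f u"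
      by blast
    define x where "x = vec ?n (\<lambda>i. f (vs ! i))"
    have x: "x \<in> carrier_vec ?n" by (simp add: x_def)
    obtain j where j: "j < ?n" "v = vs ! j" using f(1) assms(2) by (metis in_set_conv_nth)
    then have "x $ j \<noteq> 0" using f(2) by (simp add: x_def)
    then have "x \<noteq> 0\<^sub>v ?n" using j(1) by auto
    moreover have "?A *\<^sub>v x = k \<cdot>\<^sub>v x"
    proof (rule eq_vecI)
      fix i assume "i < dim_vec (k \<cdot>\<^sub>v x)"
      then have i: "i < ?n" by (simp add: x_def)
      have "vs ! i \<in> pverts G" using i assms(2) nth_mem by blast
      have "(?A *\<^sub>v x) $ i = (\<Sum>v | v \<in> pverts G \<and> (vs ! i, v) \<in> parcs G. f v)"
        by (rule row[OF x _ i]) (simp add: x_def)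
      also have "\<dots> = k * f (vs ! i)" by (rule f(3)) fact
      also have "\<dots> = (k \<cdot>\<^sub>v x) $ i" using i by (simp add: x_def)
      finally show "(?A *\<^sub>v x) $ i = (k \<cdot>\<^sub>v x) $ i" .
    qed (simp add: dim x_def)
    ultimately show ?L using x by (auto simp: eigenvalue_def eigenvector_def dim)
  qed
qed

lemma adjacency_eigenvalue_iff:
  assumes "finite (pverts G)"
  shows "adjacency_eigenvalue G k \<longleftrightarrow>
    (\<exists>f. (\<exists>v\<in>pverts G. f v \<noteq> 0) \<and>
         (\<forall>u\<in>pverts G. (\<Sum>v | v \<in> pverts G \<and> (u, v) \<in> parcs G. f v) = k * f u))"
  using finite_distinct_list[OF assms] eigenvalue_adjacency_matrix_iff[of _ G k]
  unfolding adjacency_eigenvalue_def by blast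

text \<open>The indexed constructors are used with indices from \<open>1\<close> to \<open>n\<close>.\<close>

datatype hj_vertex = Vx nat | Vx' nat | Vy nat | Vy' nat | Vp | Vq | Vr

text \<open>Both edge sets below list one orientation of each edge.\<close>

definition twisted_ladder_edges :: "nat \<Rightarrow> hj_vertex rel" where
  "twisted_ladder_edges n =
     (\<Union>i\<in>{1..n}. {(Vx i, Vy i), (Vx i, Vy' i), (Vx' i, Vy i), (Vx' i, Vy' i)}) \<union>
     (\<Union>i\<in>{1..<n}. {(Vy i, Vx (i + 1)), (Vy' i, Vx' (i + 1))})"

definition twisted_ladder :: "nat \<Rightarrow> hj_vertex pair_pre_digraph" where
  "twisted_ladder n =
     \<lparr> pverts = (\<Union>i\<in>{1..n}. {Vx i, Vx' i, Vy i, Vy' i}),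
       parcs = twisted_ladder_edges n \<union> (twisted_ladder_edges n)\<inverse> \<rparr>"

definition hj'_new_edges :: "nat \<Rightarrow> hj_vertex rel" where
  "hj'_new_edges n = {(Vx 1, Vp), (Vp, Vq), (Vq, Vr), (Vr, Vx' 1), (Vy n, Vy' n)}"

definition HJ' :: "nat \<Rightarrow> hj_vertex pair_pre_digraph" where
  "HJ' n =
     \<lparr> pverts = pverts (twisted_ladder n) \<union> {Vp, Vq, Vr},
       parcs = parcs (twisted_ladder n) \<union> hj'_new_edges n \<union> (hj'_new_edges n)\<inverse> \<rparr>"

end

(* Let A be the adjacency matrix. The spectral gap says that A^2 - I is positive semidefinite, so it is
   the Gram matrix of vectors attached to the vertices: a vertex of degree 2 or 3 gets a vector of squared
   length 1 or 2, and the inner product of two vectors is the number of common neighbours. Short linear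
   relations between the vectors (an integer combination of length 0) then force how the graph continues
   around a vertex of degree 2. If such a vertex has two neighbours of degree 2, one finds the path
   x_1 p q r x_1' and then, rung by rung, a twisted ladder that can only be closed by the edge y_n y_n'
   if the graph is not bipartite. Every other neighbourhood is contradictory or closes up to a
   bipartite graph. *)

theory Submission
  imports Defs "HOL-Analysis.Function_Topology"
begin

section \<open>The quadratic form of a graph with spectral gap\<close>

text \<open>A vertex of degree 2 is the place to start because of its unit vector v: a vector of
  squared length 2 with inner product 1 with v is v plus a unit vector orthogonal to v, and since
  all inner products are integers few configurations remain. The obstacle is that equality of
  vectors is weaker than equality of vertices. A vanishing combination only balances numbers of
  common neighbours, so each relation is tested against a well-chosen further vertex, and a positive
  number is read back as a walk of length 2. Where every test is passed, the explored vertices turn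
  out to be closed under adjacency and properly 2-coloured, and connectedness makes this a
  bipartition of the whole graph; non-bipartiteness enters in no other way. Triangles cannot be
  excluded at the outset, since x_n, y_n, y_n' form one in \<open>HJ' n\<close>. Only a triangle
  through a vertex of degree 2 is special: it already is the whole graph.\<close>

definition nbr_form :: "'a set \<Rightarrow> ('a \<Rightarrow> 'a set) \<Rightarrow> real \<Rightarrow> ('a \<Rightarrow> real) \<Rightarrow> ('a \<Rightarrow> real) \<Rightarrow> real" where
  "nbr_form V N m f g = (\<Sum>t\<in>V. sum f (N t) * sum g (N t)) - m * (\<Sum>t\<in>V. f t * g t)"

lemma nbr_form_commute: "nbr_form V N m f g = nbr_form V N m g f"
  by (simp add: nbr_form_def mult.commute)

lemma nbr_form_add_left:
  "nbr_form V N m (\<lambda>t. f t + c * h t) g = nbr_form V N m f g + c * nbr_form V N m h g"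
  by (simp add: nbr_form_def sum.distrib sum_distrib_left algebra_simps)

lemma nbr_form_add_right:
  "nbr_form V N m g (\<lambda>t. f t + c * h t) = nbr_form V N m g f + c * nbr_form V N m g h"
  by (simp only: nbr_form_commute[of V N m g] nbr_form_add_left)

text \<open>The polynomial B(f + s g, f + s g) in s is nonnegative, so its linear coefficient
  vanishes once its constant term is at most 0. Here B is the form of A^2 - m I, with A f sending t
  to the sum of f over \<open>N t\<close>.\<close>

lemma nbr_form_kernel:
  assumes psd: "\<And>f. nbr_form V N m f f \<ge> 0" and f: "nbr_form V N m f f \<le> 0"
  shows "nbr_form V N m f g = 0"
proof -
  let ?B = "nbr_form V N m"
  have B: "0 \<le> 2 * s * ?B f g + s\<^sup>2 * ?B g g" for s
  proof -
    have "0 \<le> ?B (\<lambda>t. f t + s * g t) (\<lambda>t. f t + s * g t)" by (rule psd)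
    also have "\<dots> = ?B f f + 2 * s * ?B f g + s\<^sup>2 * ?B g g"
      by (simp add: nbr_form_add_left nbr_form_add_right nbr_form_commute[of V N m g f]
          power2_eq_square algebra_simps)
    finally show ?thesis using f by linarith
  qed
  \<comment> \<open>With s = -c * B(f, g) the inequality becomes 0 \<le> -c * B(f, g)^2 * (2 - c *
    B(g, g)); this c is small enough to keep the last factor positive.\<close>
  define c where "c = 1 / (1 + ?B g g)"
  have c: "c > 0" "c * ?B g g < 1" using psd[of g] by (auto simp: c_def field_simps)
  have "0 \<le> 2 * (- c * ?B f g) * ?B f g + (- c * ?B f g)\<^sup>2 * ?B g g" by (rule B)
  also have "\<dots> = - (c * (?B f g)\<^sup>2) * (2 - c * ?B g g)"
    by (simp add: power2_eq_square algebra_simps)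
  finally have "c * (?B f g)\<^sup>2 * (2 - c * ?B g g) \<le> 0" by simp
  then show ?thesis using c by (auto simp: mult_le_0_iff)
qed

lemma sum_of_bool_mult:
  assumes "finite A"
  shows "(\<Sum>t\<in>A. of_bool (t = u) * f t) = (if u \<in> A then f u else (0 :: real))"
    and "(\<Sum>t\<in>A. f t * of_bool (t = u)) = (if u \<in> A then f u else (0 :: real))"
proof -
  have "of_bool (t = u) * f t = (if t = u then f t else 0)" "f t * of_bool (t = u) = (if t = u then f t else 0)" for t
    by simp_all
  then show "(\<Sum>t\<in>A. of_bool (t = u) * f t) = (if u \<in> A then f u else 0)"
    and "(\<Sum>t\<in>A. f t * of_bool (t = u)) = (if u \<in> A then f u else 0)"
    using assms by (simp_all only: sum.delta)
qed

text \<open>Here m is the minimum of |A f|^2 on the unit sphere over \<open>V\<close>, that is the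
  least eigenvalue of A^2, and f is a point where it is attained; homogeneity extends the bound from
  the sphere to all functions.\<close>

lemma nbr_form_minimum:
  assumes "finite V" "V \<noteq> {}" "\<And>u. N u \<subseteq> V"
  shows "\<exists>m f. (\<forall>g. nbr_form V N m g g \<ge> 0) \<and> nbr_form V N m f f = 0 \<and> (\<exists>v\<in>V. f v \<noteq> 0) \<and> m \<ge> 0"
proof -
  \<comment> \<open>Functions live on the whole type, so compactness comes from the cube of all
    functions with values in [-1, 1]; coordinates outside \<open>V\<close> affect neither the norm
    nor |A f|^2.\<close>
  define K :: "('a \<Rightarrow> real) set"
    where "K = (UNIV \<rightarrow>\<^sub>E {-1..1}) \<inter> {f. (\<Sum>t\<in>V. (f t)\<^sup>2) = 1}"
  have "compactin (product_topology (\<lambda>_. euclidean) UNIV) (UNIV \<rightarrow>\<^sub>E {-1..1::real})"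
    by (subst compactin_PiE) simp
  then have "compact ((UNIV :: 'a set) \<rightarrow>\<^sub>E {-1..1::real})"
    by (simp add: euclidean_product_topology)
  moreover have "closed {f :: 'a \<Rightarrow> real. (\<Sum>t\<in>V. (f t)\<^sup>2) = 1}"
    by (intro closed_Collect_eq continuous_on_sum continuous_on_power continuous_on_const
        continuous_on_product_coordinates)
  ultimately have K: "compact K" unfolding K_def by (rule compact_Int_closed)
  obtain v where v: "v \<in> V" using assms(2) by blast
  have "(\<lambda>t. of_bool (t = v)) \<in> K"
    using v assms(1) by (auto simp: K_def power2_eq_square sum_of_bool_mult)
  then have "K \<noteq> {}" by blast
  moreover have "continuous_on K (\<lambda>f. \<Sum>t\<in>V. (sum f (N t))\<^sup>2)"
    by (intro continuous_on_sum continuous_on_power continuous_on_subset[OF continuous_on_product_coordinates]) simp_all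
  ultimately obtain f where f: "f \<in> K"
    and min: "\<And>g. g \<in> K \<Longrightarrow> (\<Sum>t\<in>V. (sum f (N t))\<^sup>2) \<le> (\<Sum>t\<in>V. (sum g (N t))\<^sup>2)"
    using continuous_attains_inf[OF K] by blast
  define m where "m = (\<Sum>t\<in>V. (sum f (N t))\<^sup>2)"
  have form: "nbr_form V N m g g = (\<Sum>t\<in>V. (sum g (N t))\<^sup>2) - m * (\<Sum>t\<in>V. (g t)\<^sup>2)" for g
    by (simp add: nbr_form_def power2_eq_square)
  have "nbr_form V N m g g \<ge> 0" for g
  proof (cases "(\<Sum>t\<in>V. (g t)\<^sup>2) = 0")
    case True
    then show ?thesis by (simp add: form sum_nonneg)
  next
    case False
    define r where "r = sqrt (\<Sum>t\<in>V. (g t)\<^sup>2)"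
    have r2: "r\<^sup>2 = (\<Sum>t\<in>V. (g t)\<^sup>2)" by (simp add: r_def sum_nonneg)
    have r: "r > 0" using False by (simp add: r_def sum_nonneg order_less_le)
    define h where "h t = (if t \<in> V then g t / r else 0)" for t
    have h1: "(\<Sum>t\<in>V. (h t)\<^sup>2) = 1"
    proof -
      have "(\<Sum>t\<in>V. (h t)\<^sup>2) = (\<Sum>t\<in>V. (g t)\<^sup>2 / r\<^sup>2)"
        by (intro sum.cong) (simp_all add: h_def power_divide)
      also have "\<dots> = r\<^sup>2 / r\<^sup>2" unfolding r2 by (rule sum_divide_distrib[symmetric])
      finally show ?thesis using r by simp
    qed
    have "(h t)\<^sup>2 \<le> 1" for t
    proof (cases "t \<in> V")
      case True
      then have "(h t)\<^sup>2 \<le> (\<Sum>t\<in>V. (h t)\<^sup>2)" using assms(1) by (intro member_le_sum) auto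
      then show ?thesis by (simp add: h1)
    qed (simp add: h_def)
    then have "\<bar>h t\<bar> \<le> 1" for t by (simp add: abs_square_le_1)
    then have "h \<in> K" using h1 by (auto simp: K_def abs_le_iff minus_le_iff)
    then have "m \<le> (\<Sum>t\<in>V. (sum h (N t))\<^sup>2)" unfolding m_def by (rule min)
    also have "\<dots> = (\<Sum>t\<in>V. (sum g (N t))\<^sup>2) / r\<^sup>2"
    proof -
      have "sum h (N t) = sum g (N t) / r" for t
        using assms(3)[of t] by (auto simp: h_def sum_divide_distrib intro!: sum.cong)
      then show ?thesis by (simp only: power_divide sum_divide_distrib[symmetric])
    qed
    finally have "m * r\<^sup>2 \<le> (\<Sum>t\<in>V. (sum g (N t))\<^sup>2)" using r by (simp add: field_simps)
    then show ?thesis by (simp add: form r2)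
  qed
  moreover have "nbr_form V N m f f = 0" using f by (simp add: nbr_form_def K_def m_def power2_eq_square)
  moreover have "\<exists>v\<in>V. f v \<noteq> 0"
  proof (rule ccontr)
    assume "\<not> (\<exists>v\<in>V. f v \<noteq> 0)"
    then have "(\<Sum>t\<in>V. (f t)\<^sup>2) = 0" by simp
    then show False using f by (simp add: K_def)
  qed
  moreover have "m \<ge> 0" by (simp add: m_def sum_nonneg)
  ultimately show ?thesis by blast
qed

text \<open>If the minimum m were below 1, the minimiser h would satisfy (A - \<mu>)(A + \<mu>) h =
  0 for \<mu> = \<open>sqrt m\<close>. Then either (A + \<mu>) h is an eigenvector for \<mu>, or h
  is one for -\<mu>; both values lie in the gap.\<close>

lemma nbr_form_nonneg:
  assumes fin: "finite V" and sub: "\<And>u. N u \<subseteq> V" and sym: "\<And>u v. u \<in> N v \<longleftrightarrow> v \<in> N u"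
    and gap: "\<And>k g. \<lbrakk>-1 < k; k < 1; \<And>u. u \<in> V \<Longrightarrow> sum g (N u) = k * g u\<rbrakk> \<Longrightarrow> \<forall>v\<in>V. g v = (0::real)"
  shows "nbr_form V N 1 f f \<ge> 0"
proof (cases "V = {}")
  case True
  then show ?thesis by (simp add: nbr_form_def)
next
  case False
  from nbr_form_minimum[of V N, OF fin False sub]
  obtain m h where "\<forall>g. nbr_form V N m g g \<ge> 0" and h: "nbr_form V N m h h = 0"
    "\<exists>v\<in>V. h v \<noteq> 0" and m: "m \<ge> 0"
    by (elim exE conjE) 
  then have psd: "nbr_form V N m g g \<ge> 0" for g by blast
  have "m \<ge> 1"
  proof (rule ccontr)
    assume "\<not> m \<ge> 1"
    define \<mu> where "\<mu> = sqrt m"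
    have \<mu>: "0 \<le> \<mu>" "\<mu> < 1" "\<mu> * \<mu> = m" using m \<open>\<not> m \<ge> 1\<close> by (auto simp: \<mu>_def)
    define e where "e u = sum h (N u)" for u
    have finN: "finite (N u)" for u using fin sub finite_subset by blast
    have e: "sum e (N u) = m * h u" if u: "u \<in> V" for u
    proof -
      have "nbr_form V N m h (\<lambda>t. of_bool (t = u)) = 0"
        using nbr_form_kernel[OF psd] h(1) by simp
      moreover have "(\<Sum>t\<in>V. e t * (\<Sum>s\<in>N t. of_bool (s = u))) = sum e (N u)"
      proof -
        have "(\<Sum>t\<in>V. e t * (\<Sum>s\<in>N t. of_bool (s = u))) = (\<Sum>t\<in>V. if t \<in> N u then e t else 0)"
          using finN sym by (intro sum.cong) (simp_all add: of_bool_def)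
        also have "\<dots> = sum e (V \<inter> N u)" using fin by (rule sum.inter_restrict[symmetric])
        also have "V \<inter> N u = N u" using sub by blast
        finally show ?thesis .
      qed
      moreover have "(\<Sum>t\<in>V. h t * of_bool (t = u)) = h u" using u fin by (simp only: sum_of_bool_mult if_True)
      ultimately show ?thesis by (simp only: nbr_form_def e_def)
    qed
    define g where "g u = e u + \<mu> * h u" for u
    have g: "sum g (N u) = \<mu> * g u" if "u \<in> V" for u
    proof -
      have "sum g (N u) = sum e (N u) + \<mu> * e u"
        by (simp add: g_def sum.distrib sum_distrib_left[symmetric] e_def[of u])
      also have "\<dots> = \<mu> * (e u + \<mu> * h u)"
        by (simp only: e[OF that] \<mu>(3)[symmetric] distrib_left mult.assoc add.commute)
      finally show ?thesis by (simp only: g_def)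
    qed
    have "\<forall>v\<in>V. g v = 0"
    proof (rule gap)
      show "-1 < \<mu>" "\<mu> < 1" using \<mu> by linarith+
    qed (rule g)
    then have h0: "sum h (N u) = - \<mu> * h u" if "u \<in> V" for u
      using that by (simp add: g_def e_def add_eq_0_iff2)
    have "\<forall>v\<in>V. h v = 0"
    proof (rule gap)
      show "-1 < - \<mu>" "- \<mu> < 1" using \<mu> by linarith+
    qed (rule h0)
    with h(2) show False by blast
  qed
  moreover have "0 \<le> (\<Sum>t\<in>V. f t * f t)" by (simp add: sum_nonneg)
  ultimately have "1 * (\<Sum>t\<in>V. f t * f t) \<le> m * (\<Sum>t\<in>V. f t * f t)" by (intro mult_right_mono)
  with psd[of f] show ?thesis by (simp add: nbr_form_def)
qed

section \<open>Common neighbours in a graph with spectral gap\<close>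

text \<open>The graph is given by its neighbourhood function, with \<open>psd\<close> standing for
  the spectral gap and connectedness stated through sets closed under neighbours. Outside
  \<open>V\<close> the set \<open>N u\<close> is empty, which is why \<open>card_N_le\<close>
  carries no membership condition.\<close>

locale gap_graph =
  fixes V :: "'a set" and N :: "'a \<Rightarrow> 'a set"
  assumes finite_V: "finite V"
    and N_subset: "N u \<subseteq> V"
    and N_sym: "u \<in> N v \<longleftrightarrow> v \<in> N u"
    and N_irrefl: "u \<notin> N u"
    and card_N_ge: "u \<in> V \<Longrightarrow> 2 \<le> card (N u)"
    and card_N_le: "card (N u) \<le> 3"
    and psd: "nbr_form V N 1 f f \<ge> 0"
    and connected: "\<lbrakk>S \<subseteq> V; S \<noteq> {}; \<And>u. u \<in> S \<Longrightarrow> N u \<subseteq> S\<rbrakk> \<Longrightarrow> S = V"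
    and not_bipartite: "\<lbrakk>U \<union> W = V; U \<inter> W = {}; \<And>u. u \<in> U \<Longrightarrow> N u \<subseteq> W; \<And>w. w \<in> W \<Longrightarrow> N w \<subseteq> U\<rbrakk> \<Longrightarrow> False"
begin

lemma finite_N: "finite (N u)"
  using finite_subset[OF N_subset finite_V] .

lemma N_V: "u \<in> N v \<Longrightarrow> u \<in> V"
  using N_subset by blast

lemma N_V': "u \<in> N v \<Longrightarrow> v \<in> V"
  using N_subset N_sym by blast

lemma N_not_refl: "u \<in> N v \<Longrightarrow> u \<noteq> v"
  using N_irrefl by blast

lemma N_empty_iff: "N u = {} \<longleftrightarrow> u \<notin> V"
  using card_N_ge[of u] N_V'[of _ u] by fastforce

text \<open>The entries of $A^2 - I$, where $A$ is the adjacency matrix.\<close>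

definition M :: "'a \<Rightarrow> 'a \<Rightarrow> int" where
  "M u w = int (card (N u \<inter> N w)) - of_bool (u = w \<and> N u \<noteq> {})"

text \<open>Lists of coefficients and vertices let the simplifier unfold a squared length into
  finitely many entries of \<open>M\<close>. A vertex may occur under several names; its
  coefficients then add up.\<close>

definition lin_comb :: "(int \<times> 'a) list \<Rightarrow> 'a \<Rightarrow> real" where
  "lin_comb xs t = (\<Sum>(c, u)\<leftarrow>xs. real_of_int c * of_bool (t = u))"

lemma M_commute: "M u w = M w u"
  by (auto simp: M_def Int_commute)

lemma nbr_form_indicator:
  "nbr_form V N 1 (\<lambda>t. of_bool (t = u)) (\<lambda>t. of_bool (t = w)) = real_of_int (M u w)"
proof -
  have s: "(\<Sum>t\<in>N x. of_bool (t = y)) = (of_bool (x \<in> N y) :: real)" for x y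
    using finite_N[of x] N_sym[of x y] by (simp add: of_bool_def)
  have "(\<Sum>t\<in>V. of_bool (t \<in> N u) * of_bool (t \<in> N w)) = (\<Sum>t\<in>V. of_bool (t \<in> N u \<inter> N w) :: real)"
    by (intro sum.cong) simp_all
  also have "\<dots> = real (card (V \<inter> (N u \<inter> N w)))"
    using finite_V by (simp only: of_bool_def sum.inter_restrict[symmetric]) simp
  also have "V \<inter> (N u \<inter> N w) = N u \<inter> N w" using N_subset by blast
  finally have 1: "(\<Sum>t\<in>V. of_bool (t \<in> N u) * of_bool (t \<in> N w)) = real (card (N u \<inter> N w))" .
  have 2: "(\<Sum>t\<in>V. of_bool (t = u) * of_bool (t = w)) = (of_bool (u = w \<and> N u \<noteq> {}) :: real)"
    using sum_of_bool_mult(1)[OF finite_V, of u "\<lambda>t. of_bool (t = w)"] by (auto simp: N_empty_iff)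
  show ?thesis unfolding nbr_form_def s 1 2 by (simp add: M_def)
qed

lemma nbr_form_lin_comb:
  "nbr_form V N 1 (lin_comb xs) g = (\<Sum>(c, u)\<leftarrow>xs. real_of_int c * nbr_form V N 1 (\<lambda>t. of_bool (t = u)) g)"
proof (induction xs)
  case Nil
  then show ?case by (simp add: lin_comb_def nbr_form_def)
next
  case (Cons p xs)
  obtain c u where p: "p = (c, u)" by (cases p)
  have "lin_comb (p # xs) = (\<lambda>t. lin_comb xs t + real_of_int c * of_bool (t = u))"
    by (simp add: lin_comb_def p fun_eq_iff)
  then show ?case using Cons by (simp add: nbr_form_add_left p)
qed

lemma nbr_form_lin_comb_M:
  "nbr_form V N 1 (lin_comb xs) (\<lambda>t. of_bool (t = w)) = real_of_int (\<Sum>(c, u)\<leftarrow>xs. c * M u w)"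
  unfolding nbr_form_lin_comb nbr_form_indicator by (induction xs) auto

lemma nbr_form_lin_comb2:
  "nbr_form V N 1 (lin_comb xs) (lin_comb ys) = real_of_int (\<Sum>(d, w)\<leftarrow>ys. d * (\<Sum>(c, u)\<leftarrow>xs. c * M u w))"
proof -
  have "nbr_form V N 1 (lin_comb xs) (lin_comb ys) =
      (\<Sum>(d, w)\<leftarrow>ys. real_of_int d * nbr_form V N 1 (lin_comb xs) (\<lambda>t. of_bool (t = w)))"
    using nbr_form_lin_comb[of ys "lin_comb xs"] by (simp only: nbr_form_commute[of V N 1 "lin_comb xs" "lin_comb ys"] nbr_form_commute[of V N 1 "lin_comb xs" "\<lambda>t. of_bool (t = _)"])
  also have "\<dots> = real_of_int (\<Sum>(d, w)\<leftarrow>ys. d * (\<Sum>(c, u)\<leftarrow>xs. c * M u w))"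
    unfolding nbr_form_lin_comb_M by (induction ys) auto
  finally show ?thesis .
qed

text \<open>A combination of Gram vectors of length 0 is the zero vector, hence orthogonal to every
  vertex. Only an upper bound on the squared length is required, so estimates such as
  \<open>M_self_le\<close> can be fed in directly.\<close>

lemma M_kernel:
  assumes "(\<Sum>(d, w)\<leftarrow>xs. d * (\<Sum>(c, u)\<leftarrow>xs. c * M u w)) \<le> 0"
  shows "(\<Sum>(c, u)\<leftarrow>xs. c * M u t) = 0"
proof -
  have "nbr_form V N 1 (lin_comb xs) (lin_comb xs) \<le> 0"
    unfolding nbr_form_lin_comb2 using assms by simp
  then have "nbr_form V N 1 (lin_comb xs) (\<lambda>s. of_bool (s = t)) = 0"
    by (rule nbr_form_kernel[OF psd])
  then show ?thesis
    by (simp only: nbr_form_lin_comb_M of_int_eq_0_iff)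
qed

lemma M_psd: "(\<Sum>(d, w)\<leftarrow>xs. d * (\<Sum>(c, u)\<leftarrow>xs. c * M u w)) \<ge> 0"
  using psd[of "lin_comb xs"] unfolding nbr_form_lin_comb2 by simp

lemma M_self: "u \<in> V \<Longrightarrow> M u u = int (card (N u)) - 1"
  using N_empty_iff[of u] by (simp add: M_def)

lemma M_self2: "card (N u) = 2 \<Longrightarrow> M u u = 1"
  and M_self3: "card (N u) = 3 \<Longrightarrow> M u u = 2"
  by (auto simp: M_def)

lemma card_N_cases: "u \<in> V \<Longrightarrow> card (N u) = 2 \<or> card (N u) = 3"
  using card_N_ge[of u] card_N_le[of u] by linarith

lemma M_self_le: "M u u \<le> 2"
  using card_N_le[of u] by (auto simp: M_def)

lemma M_nonneg: "u \<noteq> w \<Longrightarrow> M u w \<ge> 0"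
  by (simp add: M_def)

lemma M_nonneg_V: "u \<in> V \<Longrightarrow> 0 \<le> M u w"
  using M_nonneg[of u w] M_self[of u] card_N_ge[of u] by (cases "u = w") auto

lemma M_common:
  assumes "u \<noteq> w" "x \<in> N u" "x \<in> N w"
  shows "M u w \<ge> 1"
proof -
  have "card {x} \<le> card (N u \<inter> N w)" using assms finite_N by (intro card_mono) auto
  then show ?thesis using assms(1) by (simp add: M_def)
qed

lemma M_common2:
  assumes "u \<noteq> w" "x \<in> N u" "x \<in> N w" "y \<in> N u" "y \<in> N w" "x \<noteq> y"
  shows "M u w \<ge> 2"
proof -
  have "card {x, y} \<le> card (N u \<inter> N w)" using assms finite_N by (intro card_mono) auto
  then show ?thesis using assms(1,6) by (simp add: M_def)
qed

lemma M_common3: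
  assumes "u \<noteq> w" "x \<in> N u" "x \<in> N w" "y \<in> N u" "y \<in> N w" "z \<in> N u" "z \<in> N w"
    "x \<noteq> y" "x \<noteq> z" "y \<noteq> z"
  shows "M u w \<ge> 3"
proof -
  have "card {x, y, z} \<le> card (N u \<inter> N w)" using assms finite_N by (intro card_mono) auto
  then show ?thesis using assms(1,8-10) by (simp add: M_def)
qed

lemma M_posE:
  assumes "M u w \<ge> 1"
  obtains x where "x \<in> N u" "x \<in> N w"
proof -
  have "N u \<inter> N w \<noteq> {}" using assms by (auto simp: M_def of_bool_def split: if_splits)
  then show ?thesis using that by blast
qed

lemma M_posD:
  assumes "M u w \<ge> 1" shows "\<exists>x\<in>N u. w \<in> N x"
proof -
  obtain x where "x \<in> N u" "x \<in> N w" using M_posE[OF assms] .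
  then show ?thesis using N_sym[of x w] by blast
qed

lemma M_adj_nonneg:
  assumes "z \<in> N w" shows "0 \<le> M w z" "0 \<le> M z w"
  using M_nonneg[of w z] M_nonneg[of z w] N_not_refl[OF assms] by simp_all

lemma M_zero: "(\<And>x. x \<in> N u \<Longrightarrow> x \<notin> N w) \<Longrightarrow> u \<noteq> w \<Longrightarrow> M u w = 0"
  using M_posE[of u w] M_nonneg[of u w] by fastforce

lemma M_eval2:
  assumes "N u = {x, y}" "x \<noteq> y" "u \<noteq> w"
  shows "M u w = of_bool (w \<in> N x) + of_bool (w \<in> N y)"
  unfolding M_def assms(1) N_sym[of w x] N_sym[of w y] using assms(2,3) by (simp add: Int_insert_left)

lemma M_eval3:
  assumes "N u = {x, y, z}" "x \<noteq> y" "x \<noteq> z" "y \<noteq> z" "u \<noteq> w"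
  shows "M u w = of_bool (w \<in> N x) + of_bool (w \<in> N y) + of_bool (w \<in> N z)"
  unfolding M_def assms(1) N_sym[of w x] N_sym[of w y] N_sym[of w z]
  using assms(2-) by (simp add: Int_insert_left)

text \<open>The squared length of u - w is at most 4 - 2 * \<open>M u w\<close>.\<close>

lemma M_le2:
  assumes "u \<noteq> w" shows "M u w \<le> 2"
  using M_psd[of "[(1, u), (-1, w)]"] M_self_le[of u] M_self_le[of w] M_commute[of u w] by simp

text \<open>The squared length of 2u - w is at most 6 - 4 * \<open>M u w\<close>, and
  \<open>M u w\<close> is an integer.\<close>

lemma M_le1:
  assumes "u \<noteq> w" "card (N u) = 2"
  shows "M u w \<le> 1"
  using M_psd[of "[(2, u), (-1, w)]"] M_self2[OF assms(2)] M_self_le[of w] M_commute[of u w] by simp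

text \<open>A unit vector has product at most 1 with any other vertex, so no 4-cycle passes through
  a vertex of degree 2.\<close>

lemma no_common2:
  assumes "card (N u) = 2" "x \<in> N u" "y \<in> N u" "x \<in> N w" "y \<in> N w" "x \<noteq> y"
  shows "w = u"
  using M_common2[of u w x y] M_le1[of u w] assms by fastforce

text \<open>Products of distinct vertices are at most 2, which excludes K_{2,3} as a
  subgraph.\<close>

lemma no_common3:
  assumes "x \<in> N u" "x \<in> N w" "y \<in> N u" "y \<in> N w" "z \<in> N u" "z \<in> N w"
    "x \<noteq> y" "x \<noteq> z" "y \<noteq> z"
  shows "u = w"
  using M_common3[of u w x y z] M_le2[of u w] assms by fastforce

lemma card3_of_common2:
  assumes "M u w \<ge> 2" "u \<noteq> w" "u \<in> V"
  shows "card (N u) = 3"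
  using M_le1[of u w] card_N_cases[of u] assms by fastforce

text \<open>The vector u - w has squared length at most 0, so u and w have the same vector. The
  vertices may still differ, as p and r or y_i and y_i' do in \<open>HJ' n\<close>.\<close>

lemma twin:
  assumes "M u u = M w w" "M u w \<ge> M u u"
  shows "M u t = M w t"
  using M_kernel[of "[(1, u), (-1, w)]" t] assms M_commute[of u w] by simp

lemma twin2:
  assumes "card (N u) = 2" "card (N w) = 2" "M u w \<ge> 1"
  shows "M u t = M w t"
  using twin[of u w] assms by (simp add: M_self2)

lemma twin3:
  assumes "M u w \<ge> 2" "u \<in> V" "w \<in> V"
  shows "M u t = M w t"
proof (cases "u = w")
  case False
  then show ?thesis
    using twin[of u w t] card3_of_common2[of u w] card3_of_common2[of w u] assms M_commute[of u w]
    by (simp add: M_self3)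
qed simp

text \<open>In the lattice with Gram matrix $A^2 - I$, orthogonal vectors $s = v + f$ and $t = v + g$ of norm 2
  over a common unit vector $v$ satisfy $g = -f$.\<close>

lemma opposite:
  assumes "card (N v) = 2" "M v s \<ge> 1" "M v t \<ge> 1" "M s t = 0"
  shows "M s x + M t x = 2 * M v x" and "s \<in> V \<Longrightarrow> card (N s) = 3"
  using M_kernel[of "[(1, s), (1, t), (-2, v)]" x] M_psd[of "[(1, s), (1, t), (-2, v)]"]
    assms M_self2[OF assms(1)] M_self_le[of s] M_self_le[of t] M_self2[of s] card_N_cases[of s]
    M_commute[of s t] M_commute[of v s] M_commute[of v t] by auto

text \<open>Here $b = a + g$ and $c = a + h$ with orthonormal $a$, $g$, $h$, and the conclusion is $s = g + h$.\<close>

lemma third_root: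
  assumes "card (N a) = 2" "M b c = 1" "M a b = 1" "M a c = 1" "M s a = 0" "M s b \<ge> 1" "M s c \<ge> 1"
  shows "M s x = M b x + M c x - 2 * M a x"
proof -
  have le: "M b b \<le> 2" "M c c \<le> 2" "M s s \<le> 2" and a: "M a a = 1"
    using assms(1) by (simp_all add: M_self_le M_self2)
  note comm = M_commute[of b s] M_commute[of c s] M_commute[of a s] M_commute[of b a] M_commute[of c a] M_commute[of c b]
  show ?thesis
    using M_kernel[of "[(1, s), (-1, b), (-1, c), (2, a)]" x] le a comm assms by simp
qed

text \<open>If \<open>U\<close> and \<open>W\<close> overlapped, their intersection would be all of \<open>V\<close>; hence a single vertex
  outside \<open>W\<close> certifies that they are disjoint.\<close>

lemma bipartition_closed:
  assumes U: "\<And>u. u \<in> U \<Longrightarrow> N u \<subseteq> W" and W: "\<And>w. w \<in> W \<Longrightarrow> N w \<subseteq> U"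
    and v: "v \<in> U" "v \<notin> W" "v \<in> V"
  shows False
proof -
  have UW: "U \<inter> V \<union> W \<inter> V = V"
  proof (rule connected)
    fix u assume "u \<in> U \<inter> V \<union> W \<inter> V"
    then show "N u \<subseteq> U \<inter> V \<union> W \<inter> V" using U[of u] W[of u] N_subset[of u] by blast
  qed (use v in auto)
  have "(U \<inter> V) \<inter> (W \<inter> V) = {}"
  proof (rule ccontr)
    assume "(U \<inter> V) \<inter> (W \<inter> V) \<noteq> {}"
    then have "(U \<inter> V) \<inter> (W \<inter> V) = V"
    proof (rule connected[rotated])
      fix u assume "u \<in> (U \<inter> V) \<inter> (W \<inter> V)"
      then show "N u \<subseteq> (U \<inter> V) \<inter> (W \<inter> V)" using U[of u] W[of u] N_subset[of u] by blast
    qed auto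
    then show False using v by blast
  qed
  with UW show False
  proof (rule not_bipartite)
    show "N u \<subseteq> W \<inter> V" if "u \<in> U \<inter> V" for u using that U N_subset by blast
    show "N u \<subseteq> U \<inter> V" if "u \<in> W \<inter> V" for u using that W N_subset by blast
  qed
qed

lemma N2I: "card (N u) = 2 \<Longrightarrow> x \<in> N u \<Longrightarrow> y \<in> N u \<Longrightarrow> x \<noteq> y \<Longrightarrow> N u = {x, y}"
  using finite_N[of u] by (intro card_seteq[symmetric]) auto

lemma N3I: "x \<in> N u \<Longrightarrow> y \<in> N u \<Longrightarrow> z \<in> N u \<Longrightarrow> x \<noteq> y \<Longrightarrow> x \<noteq> z \<Longrightarrow> y \<noteq> z \<Longrightarrow> N u = {x, y, z}"
  using finite_N[of u] card_N_le[of u] by (intro card_seteq[symmetric]) auto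

lemma N2E:
  assumes "card (N u) = 2" "x \<in> N u"
  obtains y where "N u = {x, y}" "x \<noteq> y"
proof -
  have "card (N u - {x}) = 1" using assms finite_N by simp
  then obtain y where y: "N u - {x} = {y}" by (rule card_1_singletonE)
  show ?thesis by (rule that[of y]) (use y assms(2) in auto)
qed

lemma N3E:
  assumes "card (N u) = 3" "x \<in> N u"
  obtains y z where "N u = {x, y, z}" "x \<noteq> y" "x \<noteq> z" "y \<noteq> z"
proof -
  have "card (N u - {x}) = 2" using assms finite_N by simp
  then obtain y z where y: "N u - {x} = {y, z}" "y \<noteq> z" by (auto simp: card_2_iff)
  show ?thesis by (rule that[of y z]) (use y assms(2) in auto)
qed

lemma N3E2:
  assumes "card (N u) = 3" "x \<in> N u" "y \<in> N u" "x \<noteq> y"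
  obtains z where "N u = {x, y, z}" "x \<noteq> z" "y \<noteq> z"
proof -
  have "card (N u - {x, y}) = 1" using assms finite_N by simp
  then obtain z where z: "N u - {x, y} = {z}" by (rule card_1_singletonE)
  show ?thesis by (rule that[of z]) (use z assms(2,3) in auto)
qed

lemma N_other:
  assumes "x \<in> N u"
  obtains y where "y \<in> N u" "y \<noteq> x"
proof -
  have "u \<in> V" using N_V'[OF assms] .
  then have "card (N u) \<ge> 2" by (rule card_N_ge)
  then have "N u \<noteq> {x}" by auto
  then show ?thesis using assms that by blast
qed

section \<open>Triangles through a vertex of degree 2\<close>

text \<open>A third neighbour w of b would give b + w = 2v as vectors. Then a vertex with positive
  product with b and nonnegative product with w has positive product with v, which fails for a
  further neighbour z of w. Most uses of \<open>opposite\<close> below end in this way.\<close>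

lemma triangle_deg2:
  assumes v: "N v = {a, b}" "a \<noteq> b" and ab: "b \<in> N a" and a2: "card (N a) = 2"
  shows "N a = {v, b}" "N b = {v, a}"
proof -
  have v2: "card (N v) = 2" using v by simp
  have sym: "v \<in> N a" "v \<in> N b" "a \<in> N b" using v ab N_sym by blast+
  have ne: "v \<noteq> a" "v \<noteq> b" using sym N_not_refl by blast+
  show Na: "N a = {v, b}" using N2I[OF a2 sym(1) ab ne(2)] .
  show "N b = {v, a}"
  proof (rule ccontr)
    assume "N b \<noteq> {v, a}"
    then have "card (N b) \<noteq> 2" using N2I[of b v a] sym ne by blast
    then have "card (N b) = 3" using card_N_cases[of b] N_V[OF ab] by blast
    then obtain w where w: "N b = {v, a, w}" "v \<noteq> w" "a \<noteq> w" using N3E2[of b v a] sym ne by metis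
    have bw: "b \<in> N w" "w \<noteq> b" using w(1) N_sym[of w b] N_irrefl[of b] by auto
    have "M v w = 1" using w(2) bw(2) by (simp add: M_eval2[OF v w(2)] Na w(1))
    moreover have "M b w = 0" using M_eval3[OF w(1) ne(1) w(2,3), of w] Na w v ne bw N_irrefl[of w] by auto
    moreover have "M v b = 1" using M_eval2[OF v ne(2)] ab N_irrefl[of b] by auto
    ultimately have opp: "M b x + M w x = 2 * M v x" for x using opposite(1)[OF v2, of b w x] by simp
    obtain z where z: "z \<in> N w" "z \<noteq> b" using N_other[OF bw(1)] .
    have wz: "w \<in> N z" using z(1) N_sym by blast
    have "M b z \<ge> 1" using M_common[of b z w] z w wz by auto
    moreover have "M w z \<ge> 0" using M_adj_nonneg(1)[OF z(1)] .
    moreover have "M v z = 0"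
    proof -
      have "z \<noteq> v" "z \<noteq> a" "z \<noteq> w" using wz v w bw Na N_irrefl[of w] ne by auto
      then show ?thesis using M_eval2[OF v, of z] Na w z by auto
    qed
    ultimately show False using opp[of z] by linarith
  qed
qed

text \<open>The third neighbour c of a satisfies c + a = 2v as vectors and therefore has degree 3. A
  neighbour of c other than a shares c with a, so it has positive product with v, and only d
  qualifies; but two such neighbours are needed.\<close>

lemma no_triangle_deg3:
  assumes v: "N v = {a, b}" "a \<noteq> b" and ab: "b \<in> N a" and d3: "card (N a) = 3" "card (N b) = 3"
  shows False
proof -
  have v2: "card (N v) = 2" using v by simp
  have sym: "v \<in> N a" "v \<in> N b" "a \<in> N b" using v ab N_sym by blast+
  have ne: "v \<noteq> a" "v \<noteq> b" using sym N_not_refl by blast+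
  obtain c where c: "N a = {v, b, c}" "v \<noteq> c" "b \<noteq> c" using N3E2[OF d3(1) sym(1) ab ne(2)] .
  obtain d where d: "N b = {v, a, d}" "v \<noteq> d" "a \<noteq> d" using N3E2[OF d3(2) sym(2,3) ne(1)] .
  have ac: "a \<in> N c" "b \<in> N d" using c d N_sym by blast+
  have "c \<noteq> d" using no_common2[OF v2, of a b c] ac v c by auto
  have nca: "c \<noteq> a" using ac N_not_refl by blast
  have "M v c \<ge> 1" using M_common[of v c a] v c ac by auto
  moreover have "M v a \<ge> 1" using M_common[of v a b] v ab ne by auto
  moreover have "M a c = 0"
    using M_eval3[OF c(1) ne(2) c(2,3), of c] v c d nca \<open>c \<noteq> d\<close> N_irrefl[of c] by auto
  ultimately have opp: "M c x + M a x = 2 * M v x" and c3: "card (N c) = 3" for x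
    using opposite(1)[OF v2, of c a x] opposite(2)[OF v2, of c a] M_commute[of c a] N_V'[OF ac(1)] by auto
  have "z = d" if z: "z \<in> N c" "z \<noteq> a" for z
  proof -
    have cz: "c \<in> N z" using z N_sym by blast
    have "M a z \<ge> 1" using M_common[of a z c] z c cz by auto
    moreover have "M c z \<ge> 0" using M_adj_nonneg(1)[OF z(1)] .
    ultimately have "M v z \<ge> 1" using opp[of z] by linarith
    then have "z \<in> N a \<or> z \<in> N b" using M_posD[of v z] v by auto
    moreover have "z \<noteq> v" using cz v c nca by auto
    moreover have "z \<noteq> b" using cz d c nca \<open>c \<noteq> d\<close> by auto
    moreover have "z \<noteq> c" using z N_not_refl by blast
    ultimately show ?thesis using c d z \<open>z \<noteq> v\<close> by auto
  qed
  moreover obtain y z where "N c = {a, y, z}" "a \<noteq> y" "a \<noteq> z" "y \<noteq> z" using N3E[OF c3 ac(1)] .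
  ultimately show False by blast
qed

lemma triangle:
  assumes v: "N v = {a, b}" "a \<noteq> b" and ab: "b \<in> N a"
  shows "V = {v, a, b}" "N a = {v, b}" "N b = {v, a}"
proof -
  have ba: "a \<in> N b" using ab N_sym by blast
  have "card (N a) = 2 \<or> card (N b) = 2"
    using no_triangle_deg3[OF v ab] card_N_cases N_V[OF ab] N_V[OF ba] by blast
  then have *: "N a = {v, b} \<and> N b = {v, a}"
  proof
    assume "card (N a) = 2"
    then show ?thesis using triangle_deg2[OF v ab] by blast
  next
    assume b2: "card (N b) = 2"
    have "N v = {b, a}" using v by blast
    then show ?thesis using triangle_deg2[OF _ _ ba b2] v(2) by blast
  qed
  then show "N a = {v, b}" "N b = {v, a}" by blast+
  have "{v, a, b} = V"
  proof (rule connected)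
    show "{v, a, b} \<subseteq> V" using N_V[of a b] N_V[of b a] N_V[of v a] ab ba * by auto
  qed (use * v in auto)
  then show "V = {v, a, b}" ..
qed

end

text \<open>Only triangles through a vertex of degree 2 are excluded.\<close>

locale triangle_free_gap_graph = gap_graph +
  assumes no_triangle: "\<lbrakk>card (N v) = 2; a \<in> N v; b \<in> N v\<rbrakk> \<Longrightarrow> b \<notin> N a"

section \<open>A vertex of degree 2 with two neighbours of degree 3\<close>

locale fork = triangle_free_gap_graph +
  fixes v a b c c' d d'
  assumes Nv: "N v = {a, b}" and Na: "N a = {v, c, c'}" and Nb: "N b = {v, d, d'}"
    and ab: "a \<noteq> b" and ne_a: "v \<noteq> c" "v \<noteq> c'" "c \<noteq> c'" and ne_b: "v \<noteq> d" "v \<noteq> d'" "d \<noteq> d'"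
begin

lemma v2: "card (N v) = 2"
  using Nv ab by simp

lemma mem: "v \<in> N a" "v \<in> N b" "a \<in> N c" "a \<in> N c'" "b \<in> N d" "b \<in> N d'"
  using Na Nb N_sym by blast+

lemma not_mem: "b \<notin> N a" "a \<notin> N b" "b \<notin> N c" "b \<notin> N c'" "a \<notin> N d" "a \<notin> N d'"
proof -
  show 1: "b \<notin> N a" "a \<notin> N b" using no_triangle[OF v2] Nv by blast+
  have "x = v" if "a \<in> N x" "b \<in> N x" for x using no_common2[OF v2 _ _ that ab] Nv by blast
  then show "b \<notin> N c" "b \<notin> N c'" "a \<notin> N d" "a \<notin> N d'" using mem ne_a ne_b by metis+
qed

lemma dist: "v \<noteq> a" "v \<noteq> b" "a \<noteq> c" "a \<noteq> c'" "a \<noteq> d" "a \<noteq> d'" "b \<noteq> c" "b \<noteq> c'" "b \<noteq> d" "b \<noteq> d'"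
  "c \<noteq> d" "c \<noteq> d'" "c' \<noteq> d" "c' \<noteq> d'"
  using mem not_mem N_irrefl by metis+

lemma in_V: "v \<in> V" "a \<in> V" "b \<in> V" "c \<in> V" "c' \<in> V" "d \<in> V" "d' \<in> V"
  using mem N_V[of _ a] N_V'[of v a] N_V'[of v b] N_V' by metis+

lemma M_v: "t \<noteq> v \<Longrightarrow> M v t = of_bool (t \<in> {c, c', d, d'})"
  using M_eval2[OF Nv ab, of t] Na Nb dist by auto

lemma M_v_pos: "M v t \<ge> 1 \<Longrightarrow> t \<in> {v, c, c', d, d'}"
  using M_v[of t] by (cases "t \<in> {c, c', d, d'}") auto

text \<open>The two branches can be exchanged, and so can the two ends of either branch. These
  instances of the locale replace arguments by symmetry: a fact proved for c transfers to c', d and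
  d'.\<close>

lemma swap_ab: "fork V N v b a d d' c c'"
  using Nv Na Nb ab ne_a ne_b by unfold_locales auto

lemma swap_c: "fork V N v a b c' c d d'"
  using Nv Na Nb ab ne_a ne_b by unfold_locales auto

lemma swap_d: "fork V N v a b c c' d' d"
  using Nv Na Nb ab ne_a ne_b by unfold_locales auto

text \<open>If c has degree 2, it has the vector of v, so its other neighbour x is adjacent to d and
  d', and these become twins. Their third neighbours y and y' then either contradict an opposite
  pair over v or close the graph up with colour classes {v, c, c', d, d'} and {a, b, x, y,
  y'}.\<close>

lemma deg2_second_nbr:
  assumes c2: "card (N c) = 2"
  shows False
proof -
  have deg2: "\<exists>x. N e = {a, x} \<and> a \<noteq> x \<and> d \<in> N x \<and> d' \<in> N x \<and> e \<in> N x"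
    if e: "e = c \<or> e = c'" "card (N e) = 2" for e
  proof -
    obtain x where x: "N e = {a, x}" "a \<noteq> x" using N2E[OF e(2)] mem e(1) by metis
    have "M v t = M e t" for t
      using twin2[OF v2 e(2)] M_v[of e] e(1) ne_a by auto
    then have "M e d = 1" "M e d' = 1" using M_v[of d] M_v[of d'] ne_b by auto
    then have "d \<in> N x" "d' \<in> N x"
      using M_eval2[OF x, of d] M_eval2[OF x, of d'] e(1) dist Na ne_b by (auto split: if_splits)
    moreover have "e \<in> N x" using x N_sym by blast
    ultimately show ?thesis using x by blast
  qed
  obtain x where Nc: "N c = {a, x}" "a \<noteq> x" and dx: "d \<in> N x" "d' \<in> N x" "c \<in> N x"
    using deg2[of c] c2 by blast
  have Nx: "N x = {c, d, d'}" using N3I[OF dx(3,1,2)] dist ne_b by blast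
  have xb: "x \<noteq> b" using dx not_mem N_sym[of c b] by blast
  have xd: "x \<in> N d" "x \<in> N d'" using dx N_sym by blast+
  have "M d d' \<ge> 2" using M_common2[of d d' b x] mem xd xb ne_b by auto
  then have d3: "card (N d) = 3" "card (N d') = 3" and twin: "M d t = M d' t" for t
    using card3_of_common2[of d d'] card3_of_common2[of d' d] twin3[of d d' t] in_V ne_b M_commute[of d d'] by auto
  obtain y where y: "N d = {b, x, y}" "b \<noteq> y" "x \<noteq> y" using N3E2[OF d3(1) mem(5) xd(1)] xb by blast
  obtain y' where y': "N d' = {b, x, y'}" "b \<noteq> y'" "x \<noteq> y'" using N3E2[OF d3(2) mem(6) xd(2)] xb by blast
  have yy: "y \<noteq> y'" using no_common3[of b d d' x y] y y' xb ne_b by auto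
  have dy: "d \<in> N y" "d' \<in> N y'" using y y' N_sym by blast+
  have ya: "y \<noteq> a" "y' \<noteq> a" using not_mem y y' by auto
  have xc': "x \<noteq> c'" using Nx mem dist by auto
  have c'3: "card (N c') = 3"
  proof (rule ccontr)
    assume "card (N c') \<noteq> 3"
    then have "card (N c') = 2" using card_N_cases in_V by blast
    then obtain z where z: "d \<in> N z" "d' \<in> N z" "c' \<in> N z" using deg2[of c'] by blast
    have "z \<in> N d" "z \<in> N d'" using z N_sym by blast+
    then have "z = b \<or> z = x" using y y' yy by auto
    then have "c' \<in> N b \<or> c' \<in> N x" using z(3) by blast
    then show False unfolding Nb Nx using ne_a dist by blast
  qed
  \<comment> \<open>An edge from c' to d or d' would make \<open>M d c'\<close> vanish, so that e
    and c' are opposite over v; the third neighbour s of c' then fails the test against v.\<close>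
  have c'd: "c' \<notin> N e" if e: "e = d \<or> e = d'" for e
  proof
    assume c'e: "c' \<in> N e"
    have notboth: "\<not> (c' \<in> N d \<and> c' \<in> N d')" using y y' yy xc' dist by auto
    have ec': "e \<in> N c'" using c'e N_sym by blast
    have "M d c' = 0"
    proof (cases "e = d")
      case True
      then have "c' = y" using c'e y xc' dist by auto
      then show ?thesis using M_eval3[OF y(1) _ y(2,3), of c'] xb Nb Nx ne_a dist N_irrefl[of c'] by auto
    next
      case False
      then have "c' = y'" using e c'e y' xc' dist by auto
      then have "M d' c' = 0" using M_eval3[OF y'(1) _ y'(2,3), of c'] xb Nb Nx ne_a dist N_irrefl[of c'] by auto
      then show ?thesis using twin by simp
    qed
    then have "M e c' = 0" using twin e by auto
    moreover have "M v e \<ge> 1" "M v c' \<ge> 1" using M_v[of e] M_v[of c'] e ne_a ne_b by auto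
    ultimately have opp: "M e t + M c' t = 2 * M v t" for t using opposite(1)[OF v2, of e c' t] by blast
    have "a \<noteq> e" using e dist by blast
    then obtain s where s: "N c' = {a, e, s}" "a \<noteq> s" "e \<noteq> s" using N3E2[OF c'3 mem(4) ec'] by blast
    have c's: "c' \<in> N s" using s N_sym by blast
    have "M e s \<ge> 1" using M_common[of e s c'] s c's c'e by auto
    moreover have "M c' s \<ge> 0" using M_nonneg N_not_refl[OF c's] by metis
    ultimately have "M v s \<ge> 1" using opp[of s] by linarith
    then have "s \<in> {v, c, c', d, d'}" by (rule M_v_pos)
    then show False using c's s Nv Nc xc' dist N_irrefl[of c'] e notboth c'e by auto
  qed
  have c'y: "c' \<noteq> y" "c' \<noteq> y'" using c'd y y' by auto
  have M1: "M d c' = of_bool (c' \<in> N y)"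
    using M_eval3[OF y(1) _ y(2,3), of c'] xb Nb Nx ne_a dist by auto
  have M2: "M d' c' = of_bool (c' \<in> N y')"
    using M_eval3[OF y'(1) _ y'(2,3), of c'] xb Nb Nx ne_a dist by auto
  have iff: "c' \<in> N y \<longleftrightarrow> c' \<in> N y'" using M1 M2 twin[of c'] by (auto split: if_splits)
  show False
  proof (cases "c' \<in> N y")
    case False
    then have "M d c' = 0" using M1 by simp
    then have opp: "M d t + M c' t = 2 * M v t" for t
      using opposite(1)[OF v2, of d c' t] M_v[of d] M_v[of c'] ne_a ne_b by auto
    obtain z where z: "z \<in> N y" "z \<noteq> d" using N_other[OF dy(1)] .
    have yz: "y \<in> N z" using z N_sym by blast
    have "z \<noteq> c'" using z False by blast
    have "M d z \<ge> 1" using M_common[of d z y] z yz y by auto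
    moreover have "M c' z \<ge> 0" using M_nonneg[of c' z] \<open>z \<noteq> c'\<close> by simp
    ultimately have "M v z \<ge> 1" using opp[of z] by linarith
    then have "z \<in> {v, c, c', d, d'}" by (rule M_v_pos)
    then show False using yz \<open>z \<noteq> c'\<close> z Nv Nc y y' yy ya by auto
  next
    case True
    then have c'y': "c' \<in> N y'" using iff by blast
    have yc': "y \<in> N c'" "y' \<in> N c'" using True c'y' N_sym by blast+
    have Nc': "N c' = {a, y, y'}" using N3I[OF mem(4) yc'] ya yy by blast
    \<comment> \<open>Sharing two neighbours with c', the vertex z has the vector of c', hence
      product 1 with v, which confines it to the second neighbours of v.\<close>
    have third: False if z: "z \<in> N p" "z \<in> N q" "z \<noteq> c'" "z \<notin> {v, c, d, d'}" "p \<in> N c'" "q \<in> N c'" "p \<noteq> q" for z p q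
    proof -
      have pz: "p \<in> N z" "q \<in> N z" using z N_sym by blast+
      have "M c' z \<ge> 2" using M_common2[of c' z p q] z pz by auto
      then have "M c' v = M z v" using twin3[of c' z v] in_V N_V'[OF pz(1)] by blast
      then have "M v z = 1" using M_v[of c'] ne_a M_commute by auto
      then show False using M_v[of z] z by auto
    qed
    have Ny: "N y \<subseteq> {d, c'}"
    proof
      fix z assume z: "z \<in> N y"
      have yz: "y \<in> N z" using z N_sym by blast
      show "z \<in> {d, c'}"
      proof (rule ccontr)
        assume n: "z \<notin> {d, c'}"
        have zd': "z \<noteq> d'" using yz y y' yy by auto
        have "M d z \<ge> 1" using M_common[of d z y] y yz n by auto
        then have "M d' z \<ge> 1" using twin by simp
        then have "z \<in> N b \<or> z \<in> N x \<or> z \<in> N y'"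
          using M_posD[of d' z] y'(1) by auto
        moreover have "z \<notin> N b" using Nb yz Nv ya y n zd' by auto
        moreover have "z \<notin> N x" using Nx yz Nc ya y n zd' by auto
        ultimately have "z \<in> N y'" by blast
        moreover have "z \<noteq> v" "z \<noteq> c" using yz Nv Nc ya y by auto
        ultimately show False using third[of z y y'] z n zd' yc' yy by auto
      qed
    qed
    have Ny': "N y' \<subseteq> {d', c'}"
    proof
      fix z assume z: "z \<in> N y'"
      have yz: "y' \<in> N z" using z N_sym by blast
      show "z \<in> {d', c'}"
      proof (rule ccontr)
        assume n: "z \<notin> {d', c'}"
        have zd: "z \<noteq> d" using yz y y' yy by auto
        have "M d' z \<ge> 1" using M_common[of d' z y'] y' yz n by auto
        then have "M d z \<ge> 1" using twin by simp
        then have "z \<in> N b \<or> z \<in> N x \<or> z \<in> N y"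
          using M_posD[of d z] y(1) by auto
        moreover have "z \<notin> N b" using Nb yz Nv ya y' n zd by auto
        moreover have "z \<notin> N x" using Nx yz Nc ya y' n zd by auto
        ultimately have "z \<in> N y" by blast
        then show False using Ny n zd by blast
      qed
    qed
    show False
    proof (rule bipartition_closed[of "{v, c, c', d, d'}" "{a, b, x, y, y'}" v])
      show "N u \<subseteq> {a, b, x, y, y'}" if "u \<in> {v, c, c', d, d'}" for u
        using that Nv Nc Nc' y y' by auto
      show "N w \<subseteq> {v, c, c', d, d'}" if "w \<in> {a, b, x, y, y'}" for w
        using that Na Nb Nx Ny Ny' by auto
      have "d \<notin> N v" "d' \<notin> N v" using Nv dist by auto
      then have "v \<noteq> x" "v \<noteq> y" "v \<noteq> y'" using dx(1) dy by auto
      then show "v \<notin> {a, b, x, y, y'}" using dist by simp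
    qed (use in_V in auto)
  qed
qed

end

section \<open>Forks in which c, c', d, d' all have degree 3\<close>

locale fork3 = fork +
  assumes c3: "card (N c) = 3" "card (N c') = 3" "card (N d) = 3" "card (N d') = 3"
begin

lemma swap3_ab: "fork3 V N v b a d d' c c'"
  using swap_ab c3 by (simp add: fork3_def fork3_axioms_def)

lemma swap3_c: "fork3 V N v a b c' c d d'"
  using swap_c c3 by (simp add: fork3_def fork3_axioms_def)

lemma swap3_d: "fork3 V N v a b c c' d' d"
  using swap_d c3 by (simp add: fork3_def fork3_axioms_def)

text \<open>If c + d = 2v as vectors, walks leaving c through a neighbour y other than a end only in
  c, c' or d'. If y were not adjacent to d', it would have just the neighbours c and c', yet two
  common neighbours with a force degree 3. So c and d' share two neighbours and are twins, although
  d' has positive product with d through b.\<close>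

lemma not_opposite: "M c d \<noteq> 0"
proof
  assume 0: "M c d = 0"
  have opp: "M c t + M d t = 2 * M v t" for t
    using opposite(1)[OF v2, of c d t] M_v[of c] M_v[of d] 0 ne_a ne_b by auto
  obtain y z where yz: "N c = {a, y, z}" "a \<noteq> y" "a \<noteq> z" "y \<noteq> z" using N3E[OF c3(1) mem(3)] .
  have "d' \<in> N y" if y: "y \<in> N c" "y \<noteq> a" for y
  proof -
    have cy: "c \<in> N y" using y N_sym by blast
    have sub: "w = c \<or> w = c' \<or> w = d'" if w: "w \<in> N y" for w
    proof (rule ccontr)
      assume n: "\<not> ?thesis"
      have yw: "y \<in> N w" using w N_sym by blast
      have "w \<noteq> d" using M_common[of c d y] 0 y yw dist by auto
      have "M c w \<ge> 1" using M_common[of c w y] y yw n by auto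
      moreover have "M d w \<ge> 0" using M_nonneg[of d w] \<open>w \<noteq> d\<close> by simp
      ultimately have "M v w \<ge> 1" using opp[of w] by linarith
      then have "w \<in> {v, c, c', d, d'}" by (rule M_v_pos)
      then have "w = v" using n \<open>w \<noteq> d\<close> by blast
      then show False using yw Nv y not_mem by auto
    qed
    show ?thesis
    proof (rule ccontr)
      assume n: "d' \<notin> N y"
      obtain w where w: "w \<in> N y" "w \<noteq> c" using N_other[OF cy] .
      then have "c' \<in> N y" using sub n by blast
      then have "M a y \<ge> 2" using M_common2[of a y c c'] Na cy y ne_a N_sym by auto
      then have "card (N y) = 3"
        using card3_of_common2[of y a] M_commute[of a y] y N_V[OF y(1)] by auto
      then obtain p q where "N y = {c, p, q}" "c \<noteq> p" "c \<noteq> q" "p \<noteq> q" using N3E cy by metis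
      then show False using sub[of p] sub[of q] n by auto
    qed
  qed
  then have "y \<in> N d'" "z \<in> N d'" using yz N_sym by auto
  then have "M c d' \<ge> 2" using M_common2[of c d' y z] yz dist by auto
  then have "M c d = M d' d" using twin3[of c d' d] in_V by blast
  moreover have "M d' d \<ge> 1" using M_common[of d' d b] mem ne_b by auto
  ultimately show False using 0 by simp
qed

lemma M_cd: "M c d \<ge> 1"
  using not_opposite M_nonneg[of c d] dist by auto

lemma M_cross: "M c d \<ge> 1" "M c d' \<ge> 1" "M c' d \<ge> 1" "M c' d' \<ge> 1"
  using M_cd fork3.M_cd[OF swap3_c] fork3.M_cd[OF swap3_d] fork3.M_cd[OF fork3.swap3_c[OF swap3_d]]
  by blast+

text \<open>Such a y is a twin of a, and c is a twin of c'. The third neighbour of d has positive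
  product with y, hence with a, and must be z or z'; the second twin relation then puts both z and
  z' next to d, where there is room for only one.\<close>

lemma no_common_cc'_d:
  assumes y: "y \<in> N c" "y \<in> N c'" "y \<in> N d" "y \<noteq> a"
  shows False
proof -
  obtain z where z: "N c = {a, y, z}" "a \<noteq> z" "y \<noteq> z" using N3E2[OF c3(1) mem(3) y(1)] y(4) by blast
  obtain z' where z': "N c' = {a, y, z'}" "a \<noteq> z'" "y \<noteq> z'" using N3E2[OF c3(2) mem(4) y(2)] y(4) by blast
  have zz: "z \<noteq> z'" using no_common3[of a c c' y z] z z' y ne_a by auto
  have yy: "c \<in> N y" "c' \<in> N y" "d \<in> N y" using y N_sym by blast+
  have Ny: "N y = {c, c', d}" using N3I[OF yy] dist ne_a by blast
  have yb: "y \<noteq> b" using yy not_mem N_sym by blast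
  have twin_a: "M a t = M y t" for t
    using twin3[of a y t] M_common2[of a y c c'] Na yy y(4) ne_a in_V N_V[OF y(1)] by auto
  have "M c c' \<ge> 2" using M_common2[of c c' a y] mem y ne_a by auto
  then have twin_c: "M c t = M c' t" for t using twin3[of c c' t] in_V by blast
  have d'y: "d' \<notin> N y" using Ny dist ne_b by auto
  have Mc: "M c t = of_bool (t \<in> N a) + of_bool (t \<in> N y) + of_bool (t \<in> N z)" if "c \<noteq> t" for t
    using M_eval3[OF z(1) _ z(2,3) that] y(4) by simp
  have Mc': "M c' t = of_bool (t \<in> N a) + of_bool (t \<in> N y) + of_bool (t \<in> N z')" if "c' \<noteq> t" for t
    using M_eval3[OF z'(1) _ z'(2,3) that] y(4) by simp
  have da: "d \<notin> N a" "d' \<notin> N a" using not_mem N_sym by blast+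
  have "z \<in> N d \<longleftrightarrow> z' \<in> N d"
    using twin_c[of d] Mc[of d] Mc'[of d] dist N_sym[of z d] N_sym[of z' d] by (auto simp: of_bool_def split: if_splits)
  have by': "b \<noteq> y" using yb by simp
  obtain w where w: "N d = {b, y, w}" "b \<noteq> w" "y \<noteq> w" using N3E2[OF c3(3) mem(5) y(3) by'] .
  have dw: "d \<in> N w" using w N_sym by blast
  have "M y w \<ge> 1" using M_common[of y w d] yy dw w by auto
  then have "M a w \<ge> 1" using twin_a by simp
  then have "w \<in> N v \<or> w \<in> N c \<or> w \<in> N c'" using M_posD[of a w] Na by auto
  moreover have "w \<noteq> a" using dw da by blast
  ultimately have "w = z \<or> w = z'" using w z z' Nv by auto
  then have "z \<in> N d" "z' \<in> N d" using \<open>z \<in> N d \<longleftrightarrow> z' \<in> N d\<close> w by auto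
  moreover have "z \<noteq> b" "z' \<noteq> b" using z z' not_mem by auto
  ultimately show False using w z z' zz by auto
qed

text \<open>Since y is adjacent to neither d nor d', the positive products of c and c' with d and d'
  must come from z and z'. Then d and d' have the three common neighbours z, z', b.\<close>

lemma no_common_cc':
  assumes y: "y \<in> N c" "y \<in> N c'" "y \<noteq> a"
  shows False
proof -
  obtain z where z: "N c = {a, y, z}" "a \<noteq> z" "y \<noteq> z" using N3E2[OF c3(1) mem(3) y(1)] y(3) by blast
  obtain z' where z': "N c' = {a, y, z'}" "a \<noteq> z'" "y \<noteq> z'" using N3E2[OF c3(2) mem(4) y(2)] y(3) by blast
  have zz: "z \<noteq> z'" using no_common3[of a c c' y z] z z' y ne_a by auto
  have zd: "z \<in> N e \<and> z' \<in> N e" if e: "e = d \<or> e = d'" for e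
  proof -
    have "y \<notin> N e" using e no_common_cc'_d[OF y(1,2) _ y(3)] fork3.no_common_cc'_d[OF swap3_d y(1,2) _ y(3)] by blast
    then have "e \<notin> N y" using N_sym by blast
    moreover have "e \<notin> N a" using not_mem N_sym e by blast
    moreover have "M c e \<ge> 1" "M c' e \<ge> 1" using M_cross e by blast+
    ultimately have "e \<in> N z" "e \<in> N z'" using M_posD[of c e] M_posD[of c' e] z z' by auto
    then show ?thesis using N_sym by blast
  qed
  have "z \<noteq> b" "z' \<noteq> b" using z z' not_mem by auto
  then show False using no_common3[of z d d' z' b] zd mem zz ne_b by auto
qed

lemma M_cc': "M c c' = 1"
proof -
  have "M c c' \<ge> 1" using M_common[of c c' a] mem ne_a by auto
  moreover have "\<not> M c c' \<ge> 2"
  proof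
    assume 2: "M c c' \<ge> 2"
    obtain y z where yz: "N c = {a, y, z}" "a \<noteq> y" "a \<noteq> z" "y \<noteq> z" using N3E[OF c3(1) mem(3)] .
    have "c' \<notin> N y" "c' \<notin> N z" using no_common_cc'[of y] no_common_cc'[of z] yz N_sym by blast+
    moreover have "c' \<in> N a" using Na by blast
    ultimately show False using 2 M_eval3[OF yz ne_a(3)] by simp
  qed
  ultimately show ?thesis by simp
qed

lemma M_dd': "M d d' = 1"
  using fork3.M_cc'[OF swap3_ab] .

lemma M_cd_1: "M c d = 1"
proof -
  obtain y z where yz: "N c = {a, y, z}" "a \<noteq> y" "a \<noteq> z" "y \<noteq> z" using N3E[OF c3(1) mem(3)] .
  have "\<not> M c d \<ge> 2"
  proof
    assume 2: "M c d \<ge> 2"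
    have "d \<notin> N a" using not_mem N_sym by blast
    then have dyz: "y \<in> N d" "z \<in> N d"
      using 2 M_eval3[OF yz dist(11)] N_sym[of y d] N_sym[of z d] by (auto simp: of_bool_def split: if_splits)
    then have "b \<noteq> y" "b \<noteq> z" using not_mem yz by auto
    then have Nd: "N d = {b, y, z}" using N3I[OF mem(5) dyz] yz by blast
    have "M d c' \<ge> 1" using M_cross(3) M_commute[of d c'] by simp
    then have "c' \<in> N y \<or> c' \<in> N z" using M_posD[of d c'] Nd not_mem N_sym[of c' b] by auto
    then show False using no_common_cc'[of y] no_common_cc'[of z] yz N_sym by blast
  qed
  then show ?thesis using M_cd by simp
qed

text \<open>Together with \<open>M_cc'\<close> and \<open>M_dd'\<close> this says that c - v, c' -
  v, d - v, d' - v are orthonormal and orthogonal to v.\<close>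

lemma M_cross_1: "M c d = 1" "M c d' = 1" "M c' d = 1" "M c' d' = 1"
  using M_cd_1 fork3.M_cd_1[OF swap3_c] fork3.M_cd_1[OF swap3_d] fork3.M_cd_1[OF fork3.swap3_c[OF swap3_d]]
  by blast+

text \<open>Product 1 gives each of the pairs c d, c d', c' d, c' d' exactly one common neighbour.
  The four are distinct because a is the only common neighbour of c and c', and b that of d and
  d'.\<close>

lemma nbrs:
  obtains y z y' z' where
    "N c = {a, y, z}" "N c' = {a, y', z'}" "N d = {b, y, y'}" "N d' = {b, z, z'}"
    "distinct [a, b, y, z, y', z']"
proof -
  have one: "\<exists>y z. N c = {a, y, z} \<and> distinct [a, b, y, z] \<and> d \<in> N y \<and> d' \<in> N z \<and> d \<notin> N z \<and> d' \<notin> N y"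
    if f: "fork3 V N v a b c c' d d'" for c c'
  proof -
    interpret f: fork3 V N v a b c c' d d' by (rule f)
    obtain y z where yz: "N c = {a, y, z}" "a \<noteq> y" "a \<noteq> z" "y \<noteq> z" using N3E[OF f.c3(1) f.mem(3)] .
    have b: "b \<noteq> y" "b \<noteq> z" using yz f.not_mem by auto
    have nb: "\<not> (d \<in> N x \<and> d' \<in> N x)" if "b \<noteq> x" for x
      using M_common2[of d d' b x] f.mem f.ne_b f.M_dd' that N_sym[of d x] N_sym[of d' x] by auto
    have "d \<notin> N a" "d' \<notin> N a" using f.not_mem N_sym by blast+
    then have "of_bool (d \<in> N y) + of_bool (d \<in> N z) = (1 :: int)" "of_bool (d' \<in> N y) + of_bool (d' \<in> N z) = (1 :: int)"
      using M_eval3[OF yz f.dist(11)] M_eval3[OF yz f.dist(12)] f.M_cross_1 by simp_all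
    then have "d \<in> N y \<and> d' \<in> N z \<and> d \<notin> N z \<and> d' \<notin> N y \<or> d \<in> N z \<and> d' \<in> N y \<and> d \<notin> N y \<and> d' \<notin> N z"
      using nb[OF b(1)] nb[OF b(2)] by (auto simp: of_bool_def split: if_splits)
    then show ?thesis
    proof
      assume "d \<in> N y \<and> d' \<in> N z \<and> d \<notin> N z \<and> d' \<notin> N y"
      then show ?thesis using yz b f.ab by auto
    next
      assume *: "d \<in> N z \<and> d' \<in> N y \<and> d \<notin> N y \<and> d' \<notin> N z"
      have "N c = {a, z, y}" using yz by blast
      then show ?thesis using * yz(2-4) b f.ab by auto
    qed
  qed
  obtain y z where yz: "N c = {a, y, z}" "distinct [a, b, y, z]" "d \<in> N y" "d' \<in> N z" "d \<notin> N z" "d' \<notin> N y"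
    using one[OF fork3_axioms] by blast
  obtain y' z' where yz': "N c' = {a, y', z'}" "distinct [a, b, y', z']" "d \<in> N y'" "d' \<in> N z'" "d \<notin> N z'" "d' \<notin> N y'"
    using one[OF swap3_c] by blast
  have "y \<notin> N c'" "z \<notin> N c'" using no_common_cc'[of y] no_common_cc'[of z] yz by auto
  then have ne: "y \<noteq> y'" "y \<noteq> z'" "z \<noteq> y'" "z \<noteq> z'" using yz' by auto
  have "y \<in> N d" "y' \<in> N d" "z \<in> N d'" "z' \<in> N d'" using yz yz' N_sym by blast+
  then have "N d = {b, y, y'}" "N d' = {b, z, z'}"
    using N3I[OF mem(5), of y y'] N3I[OF mem(6), of z z'] ne yz yz' by auto
  then show ?thesis using that yz yz' ne by auto
qed

end

section \<open>The square formed by the common neighbours y, z, y', z'\<close>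

locale fork_net = fork3 +
  fixes y z y' z'
  assumes Nc: "N c = {a, y, z}" and Nc': "N c' = {a, y', z'}"
    and Nd: "N d = {b, y, y'}" and Nd': "N d' = {b, z, z'}"
    and net_distinct: "distinct [a, b, y, z, y', z']"
begin

lemma net_swap_ab: "fork_net V N v b a d d' c c' y y' z z'"
  using swap3_ab Nc Nc' Nd Nd' net_distinct by (auto simp: fork_net_def fork_net_axioms_def)

lemma net_swap_c: "fork_net V N v a b c' c d d' y' z' y z"
  using swap3_c Nc Nc' Nd Nd' net_distinct by (auto simp: fork_net_def fork_net_axioms_def)

lemma net_swap_d: "fork_net V N v a b c c' d' d z y z' y'"
  using swap3_d Nc Nc' Nd Nd' net_distinct by (auto simp: fork_net_def fork_net_axioms_def)

lemma net_ne: "a \<noteq> y" "a \<noteq> z" "a \<noteq> y'" "a \<noteq> z'" "b \<noteq> y" "b \<noteq> z" "b \<noteq> y'" "b \<noteq> z'"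
  "y \<noteq> z" "y \<noteq> y'" "y \<noteq> z'" "z \<noteq> y'" "z \<noteq> z'" "y' \<noteq> z'"
  using net_distinct by auto

lemma mem_y: "c \<in> N y" "d \<in> N y" "c \<in> N z" "d' \<in> N z" "c' \<in> N y'" "d \<in> N y'" "c' \<in> N z'" "d' \<in> N z'"
  using Nc Nc' Nd Nd' N_sym by blast+

lemma y_V: "y \<in> V" "z \<in> V" "y' \<in> V" "z' \<in> V"
  using mem_y N_V' by blast+

lemma y_ne_c': "y \<noteq> c'"
proof
  assume y: "y = c'"
  then have "d \<in> N c'" using mem_y(2) by simp
  then have "d = z'" using Nc' mem_y(6) N_irrefl[of d] dist by auto
  then have "d \<in> N d'" using Nd' by simp
  then have "d' \<in> N d" using N_sym by blast
  then have "d' = y'" using Nd y dist by auto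
  then have "c' \<in> N d'" using mem_y(5) by simp
  then have "c' = z" using Nd' dist \<open>d = z'\<close> by auto
  then show False using y net_ne by simp
qed

lemma y_notin: "y \<notin> {v, c, c', d, d'}"
proof -
  have "c \<notin> N v" using Nv dist by auto
  then have "y \<noteq> v" using mem_y(1) by auto
  moreover have "y \<noteq> c" "y \<noteq> d" using mem_y(1,2) N_not_refl by metis+
  moreover have "y \<noteq> c'" "y \<noteq> d'" using y_ne_c' fork_net.y_ne_c'[OF net_swap_ab] by blast+
  ultimately show ?thesis by simp
qed

lemma M_ab: "M a b = 1"
  using M_eval3[OF Na ne_a ab] not_mem Nv by simp

lemma M_a_y: "M a y = 1"
  using M_eval3[OF Na ne_a, of y] y_notin net_ne Nv Nc Nc' by simp

text \<open>If y were a unit vector, \<open>third_root\<close> would give z' = a + b - 2y. The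
  product of this with z is 2 - 2 * \<open>M y z\<close>, which is at most 0 because y and z share
  c; but z' and z share d'.\<close>

lemma deg_y: "card (N y) = 3"
proof (rule ccontr)
  assume "card (N y) \<noteq> 3"
  then have y2: "card (N y) = 2" using card_N_cases y_V by blast
  have Ny: "N y = {c, d}" using N2I[OF y2 mem_y(1,2) dist(11)] .
  have "M y z' = 0" using M_eval2[OF Ny dist(11), of z'] Nc Nd net_ne by simp
  moreover have "M a z' = 1" "M b z' = 1" "M b y = 1" "M a z = 1" "M b z = 1"
    using fork_net.M_a_y[OF fork_net.net_swap_c[OF net_swap_d]]
      fork_net.M_a_y[OF fork_net.net_swap_ab[OF fork_net.net_swap_c[OF net_swap_d]]]
      fork_net.M_a_y[OF net_swap_ab] fork_net.M_a_y[OF net_swap_d]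
      fork_net.M_a_y[OF fork_net.net_swap_ab[OF net_swap_d]]
    by blast+
  ultimately have rel: "M z' z = M a z + M b z - 2 * M y z" "M a z = 1" "M b z = 1"
    using third_root[OF y2 M_ab, of z' z] M_a_y M_commute[of y a] M_commute[of y b] M_commute[of z' y]
      M_commute[of z' a] M_commute[of z' b] by simp_all
  have "M z' z \<ge> 1" using M_common[of z' z d'] mem_y net_ne Nd' by auto
  moreover have "M y z \<ge> 1" using M_common[of y z c] mem_y net_ne by auto
  ultimately show False using rel by linarith
qed

lemma third_nbr:
  obtains y3 where "N y = {c, d, y3}" "c \<noteq> y3" "d \<noteq> y3"
  using N3E2[OF deg_y mem_y(1,2) dist(11)] .

end

locale fork_net3 = fork_net +
  fixes y3 z3 y3' z3'
  assumes Ny: "N y = {c, d, y3}" and Nz: "N z = {c, d', z3}" and Ny': "N y' = {c', d, y3'}" and Nz': "N z' = {c', d', z3'}"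
    and ne3: "c \<noteq> y3" "d \<noteq> y3" "c \<noteq> z3" "d' \<noteq> z3" "c' \<noteq> y3'" "d \<noteq> y3'" "c' \<noteq> z3'" "d' \<noteq> z3'"
begin

lemma net3_swap_ab: "fork_net3 V N v b a d d' c c' y y' z z' y3 y3' z3 z3'"
  using net_swap_ab Ny Nz Ny' Nz' ne3 by (auto simp: fork_net3_def fork_net3_axioms_def)

lemma net3_swap_c: "fork_net3 V N v a b c' c d d' y' z' y z y3' z3' y3 z3"
  using net_swap_c Ny Nz Ny' Nz' ne3 by (auto simp: fork_net3_def fork_net3_axioms_def)

lemma net3_swap_d: "fork_net3 V N v a b c c' d' d z y z' y' z3 y3 z3' y3'"
  using net_swap_d Ny Nz Ny' Nz' ne3 by (auto simp: fork_net3_def fork_net3_axioms_def)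

lemma y3_mem: "y \<in> N y3"
  using Ny N_sym by blast

lemma y3_notin: "y3 \<notin> {v, c, c', d, d'}"
proof -
  have "y3 \<noteq> v" using y3_mem Nv net_ne by auto
  moreover have "y3 \<noteq> c'" "y3 \<noteq> d'" using y3_mem Nc' Nd' net_ne by auto
  ultimately show ?thesis using ne3 by auto
qed

text \<open>As a vector, y3 is (c - v) + (d - v). The four outer vertices are thus the sums of one
  of c - v, c' - v and one of d - v, d' - v.\<close>

lemma M_y3: "M y3 t = M c t + M d t - 2 * M v t"
proof -
  have "M y3 v = 0" using M_v[of y3] y3_notin M_commute[of v y3] by simp
  moreover have "M y3 c \<ge> 1" "M y3 d \<ge> 1"
    using M_common[of y3 c y] M_common[of y3 d y] y3_mem Nc Nd ne3 by auto
  moreover have "M v c = 1" "M v d = 1" using M_v[of c] M_v[of d] ne_a ne_b by simp_all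
  ultimately show ?thesis using third_root[OF v2 M_cross_1(1), of y3 t] by simp
qed

lemma M_z3: "M z3 t = M c t + M d' t - 2 * M v t"
  and M_y3': "M y3' t = M c' t + M d t - 2 * M v t"
  and M_z3': "M z3' t = M c' t + M d' t - 2 * M v t"
  using fork_net3.M_y3[OF net3_swap_d] fork_net3.M_y3[OF net3_swap_c]
    fork_net3.M_y3[OF fork_net3.net3_swap_d[OF net3_swap_c]] by blast+

lemma M_second_nbrs: "M c c = 2" "M d d = 2" "M c' c = 1" "M d c = 1" "M d' c = 1" "M c' d = 1" "M d' d = 1" "M c d = 1"
  "M v c = 1" "M v d = 1" "M v v = 1" "M c' v = 1" "M d' v = 1"
proof -
  show "M c c = 2" "M d d = 2" "M v v = 1" using M_self3 M_self2 c3 v2 by blast+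
  show "M c' c = 1" "M d c = 1" "M d' c = 1" "M c' d = 1" "M d' d = 1" "M c d = 1"
    using M_cc' M_dd' M_cross_1 by (simp_all only: M_commute[of c' c] M_commute[of d c] M_commute[of d' c] M_commute[of d' d])
  have "M v t = 1" if "t \<in> {c, c', d, d'}" for t
    using M_v[of t] that ne_a ne_b by auto
  then show "M v c = 1" "M v d = 1" "M c' v = 1" "M d' v = 1"
    by (simp_all add: M_commute[of c' v] M_commute[of d' v])
qed

lemma y3_ne: "y3 \<noteq> z3" "y3 \<noteq> y3'" "y3 \<noteq> z3'"
  using M_y3[of d] M_z3[of d] M_y3[of c] M_y3'[of c] M_z3'[of c] M_second_nbrs by auto

lemma y3_notin_N: "y3 \<notin> N z" "y3 \<notin> N y'" "y3 \<notin> N z'"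
  using Nz Ny' Nz' y3_notin y3_ne by auto

lemma M_yz: "M y z = 1" and M_yz': "M y z' = 0"
proof -
  have nz: "z \<notin> N y3" "z' \<notin> N y3" using y3_notin_N N_sym by blast+
  show "M y z = 1" "M y z' = 0"
    using M_eval3[OF Ny dist(11) ne3(1,2), of z] M_eval3[OF Ny dist(11) ne3(1,2), of z'] nz Nc Nd net_ne by auto
qed

lemma M_square: "M z y' = 0" "M y' z' = 1" "M y y' = 1" "M z z' = 1"
  using fork_net3.M_yz'[OF net3_swap_d] fork_net3.M_yz[OF net3_swap_c] fork_net3.M_yz[OF net3_swap_ab]
    fork_net3.M_yz[OF fork_net3.net3_swap_ab[OF net3_swap_d]] by blast+

lemma M_y_self: "M y y = 2" "M z z = 2" "M y' y' = 2" "M z' z' = 2"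
  using M_self3 deg_y fork_net.deg_y[OF net_swap_c] fork_net.deg_y[OF net_swap_d]
    fork_net.deg_y[OF fork_net.net_swap_c[OF net_swap_d]] by blast+

text \<open>Neighbouring corners of the square y, z, z', y' have product 1 and opposite corners
  product 0, so y + z' - z - y' has squared length 8 - 8 = 0.\<close>

lemma square_relation: "M y t + M z' t = M z t + M y' t"
  using M_kernel[of "[(1, y), (1, z'), (-1, z), (-1, y')]" t] M_yz M_yz' M_square M_y_self
    M_commute[of z y] M_commute[of z' y] M_commute[of y' z] M_commute[of z' y'] M_commute[of y' y] M_commute[of z' z]
  by simp

lemma M_y3_z3': "M y3 z3' = 0"
  using M_y3[of z3'] M_commute[of c z3'] M_commute[of d z3'] M_commute[of v z3'] M_z3'[of c] M_z3'[of d] M_z3'[of v] M_second_nbrs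
  by simp

lemma third_nbr_nbr_notin:
  assumes p: "p \<in> N y3" "p \<noteq> y"
  shows "p \<notin> N c" "p \<notin> N d" "p \<notin> N c'" "p \<notin> N d'" "p \<notin> N v" "p \<notin> N z3'" "p \<noteq> y'" "p \<noteq> z" "p \<noteq> z'"
proof -
  have y3p: "y3 \<in> N p" using p N_sym by blast
  have "p \<noteq> a" "p \<noteq> b" using y3p y3_notin Na Nb by auto
  moreover show pp: "p \<noteq> y'" "p \<noteq> z" "p \<noteq> z'" using y3p y3_notin_N by auto
  ultimately show "p \<notin> N c" "p \<notin> N d" "p \<notin> N c'" "p \<notin> N d'" "p \<notin> N v"
    using p(2) Nc Nd Nc' Nd' Nv by auto
  show "p \<notin> N z3'" using M_common[of y3 z3' p] M_y3_z3' y3_ne p by auto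
qed

lemma M_third_nbr_nbr:
  assumes p: "p \<in> N y3" "p \<noteq> y"
  shows "M p y = 1" "M p z = of_bool (p \<in> N z3)" "M p y' = of_bool (p \<in> N y3')" "M p z' = 0" "M p a = 0" "M p b = 0"
proof -
  note pf = third_nbr_nbr_notin[OF p]
  have y3p: "y3 \<in> N p" using p N_sym by blast
  have pab: "p \<noteq> a" "p \<noteq> b" using y3p y3_notin Na Nb by auto
  have "M y p = 1" using M_eval3[OF Ny dist(11) ne3(1,2), of p] pf p by simp
  moreover have "M z p = of_bool (p \<in> N z3)" using M_eval3[OF Nz dist(12) ne3(3,4), of p] pf p by simp
  moreover have "M y' p = of_bool (p \<in> N y3')" using M_eval3[OF Ny' dist(13) ne3(5,6), of p] pf p by simp
  moreover have "M z' p = 0" using M_eval3[OF Nz' dist(14) ne3(7,8), of p] pf p by simp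
  moreover have "M a p = 0" using M_eval3[OF Na ne_a, of p] pf pab by simp
  moreover have "M b p = 0" using M_eval3[OF Nb ne_b, of p] pf pab by simp
  ultimately show "M p y = 1" "M p z = of_bool (p \<in> N z3)" "M p y' = of_bool (p \<in> N y3')" "M p z' = 0" "M p a = 0" "M p b = 0"
    by (simp_all add: M_commute[of p])
qed

text \<open>All neighbours of p lie in {y3, z3}, so p is a unit vector, and this is incompatible
  with its products with y, z, a and b.\<close>

lemma no_common_third_nbr_nbr:
  assumes p: "p \<in> N y3" "p \<noteq> y" and z3: "p \<in> N z3" and y3': "p \<notin> N y3'"
  shows False
proof -
  note pf = third_nbr_nbr_notin[OF p]
  have sub: "N p \<subseteq> {y3, z3}"
  proof
    fix m assume m: "m \<in> N p"
    have pm: "p \<in> N m" using m N_sym by blast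
    show "m \<in> {y3, z3}"
    proof (rule ccontr)
      assume n: "m \<notin> {y3, z3}"
      have "M y3 m \<ge> 1" using M_common[of y3 m p] p pm n by auto
      moreover have "M v m \<ge> 0" using M_nonneg_V in_V(1) by blast
      ultimately have "M c m \<ge> 1 \<or> M d m \<ge> 1" using M_y3[of m] by linarith
      then have "m \<in> N a \<or> m \<in> N y \<or> m \<in> N z \<or> m \<in> N b \<or> m \<in> N y'"
        using M_posD[of c m] M_posD[of d m] Nc Nd by auto
      then have "m \<in> {v, c, c', d, d', y3'}" using Na Nb Ny Nz Ny' n by auto
      then show False using pm pf y3' by auto
    qed
  qed
  have y3p: "y3 \<in> N p" using p N_sym by blast
  then have "card (N p) \<le> 2" using card_mono[OF _ sub] y3_ne by simp
  then have "card (N p) = 2" using card_N_ge[OF N_V'[OF y3p]] by simp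
  then have "M p p = 1" by (rule M_self2)
  moreover have "M a a \<le> 2" by (rule M_self_le)
  moreover have "M a y = 1" "M a z = 1" "M b y = 1" "M b z = 1"
    using M_a_y fork_net.M_a_y[OF net_swap_d] fork_net.M_a_y[OF net_swap_ab]
      fork_net.M_a_y[OF fork_net.net_swap_ab[OF net_swap_d]] by blast+
  \<comment> \<open>\<open>2p = y + z - a\<close> as vectors, but the two sides have different inner products with \<open>b\<close>.\<close>
  ultimately show False
    using M_kernel[of "[(2, p), (-1, y), (-1, z), (1, a)]" b] M_third_nbr_nbr[OF p] z3 M_yz M_y_self M_ab
      M_commute[of y p] M_commute[of z p] M_commute[of a p] M_commute[of z y] M_commute[of y a] M_commute[of z a]
      M_commute[of y b] M_commute[of z b]
    by simp
qed

text \<open>Tested against p, the square relation says that p is adjacent to exactly one of z3 and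
  y3'; the two cases are mirror images under exchanging the branches.\<close>

lemma impossible_net3: False
proof -
  obtain p where p: "p \<in> N y3" "p \<noteq> y" using N_other[OF y3_mem] .
  have "of_bool (p \<in> N z3) + of_bool (p \<in> N y3') = (1 :: int)"
    using square_relation[of p] M_third_nbr_nbr[OF p] M_commute[of y p] M_commute[of z p] M_commute[of y' p] M_commute[of z' p] by simp
  then have "p \<in> N z3 \<and> p \<notin> N y3' \<or> p \<in> N y3' \<and> p \<notin> N z3" by (auto simp: of_bool_def split: if_splits)
  then show False using no_common_third_nbr_nbr[OF p] fork_net3.no_common_third_nbr_nbr[OF net3_swap_ab p] by blast
qed

end

context fork_net
begin

lemma impossible_net: False
proof -
  obtain y3 where 1: "N y = {c, d, y3}" "c \<noteq> y3" "d \<noteq> y3" using third_nbr .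
  obtain z3 where 2: "N z = {c, d', z3}" "c \<noteq> z3" "d' \<noteq> z3" using fork_net.third_nbr[OF net_swap_d] .
  obtain y3' where 3: "N y' = {c', d, y3'}" "c' \<noteq> y3'" "d \<noteq> y3'" using fork_net.third_nbr[OF net_swap_c] .
  obtain z3' where 4: "N z' = {c', d', z3'}" "c' \<noteq> z3'" "d' \<noteq> z3'"
    using fork_net.third_nbr[OF fork_net.net_swap_d[OF net_swap_c]] .
  have "fork_net3 V N v a b c c' d d' y z y' z' y3 z3 y3' z3'"
    using 1 2 3 4 by unfold_locales auto
  then show False by (rule fork_net3.impossible_net3)
qed

end

lemma (in fork3) impossible_fork3: False
proof -
  obtain y z y' z' where *: "N c = {a, y, z}" "N c' = {a, y', z'}" "N d = {b, y, y'}" "N d' = {b, z, z'}"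
    "distinct [a, b, y, z, y', z']" using nbrs .
  then have "fork_net V N v a b c c' d d' y z y' z'" by unfold_locales auto
  then show False by (rule fork_net.impossible_net)
qed

lemma (in fork) impossible_fork: False
proof -
  have "card (N c) = 3" "card (N c') = 3" "card (N d) = 3" "card (N d') = 3"
    using deg2_second_nbr fork.deg2_second_nbr[OF swap_c] fork.deg2_second_nbr[OF swap_ab]
      fork.deg2_second_nbr[OF fork.swap_c[OF swap_ab]] card_N_cases in_V by blast+
  then have "fork3 V N v a b c c' d d'" by unfold_locales auto
  then show False by (rule fork3.impossible_fork3)
qed

section \<open>Two adjacent vertices of degree 2\<close>

text \<open>The path b, v, a, c has inner vertices of degree 2 and ends of degree 3. Its inner
  vertices supply two orthogonal unit vectors v and a.\<close>

locale edge2 = triangle_free_gap_graph +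
  fixes v a b c b1 b2 c1 c2
  assumes Nv: "N v = {a, b}" and Na: "N a = {v, c}" and Nb: "N b = {v, b1, b2}" and Nc: "N c = {a, c1, c2}"
    and ab: "a \<noteq> b" and vc: "v \<noteq> c" and ne_b: "v \<noteq> b1" "v \<noteq> b2" "b1 \<noteq> b2" and ne_c: "a \<noteq> c1" "a \<noteq> c2" "c1 \<noteq> c2"
begin

lemma deg2: "card (N v) = 2" "card (N a) = 2"
  using Nv Na ab vc by simp_all

lemma mem: "v \<in> N b" "a \<in> N c" "b \<in> N b1" "b \<in> N b2" "c \<in> N c1" "c \<in> N c2" "v \<in> N a" "b1 \<in> N b" "c1 \<in> N c"
  using Nb Nc Na N_sym by blast+

lemma in_V: "v \<in> V" "a \<in> V" "b \<in> V" "c \<in> V" "b1 \<in> V" "b2 \<in> V" "c1 \<in> V" "c2 \<in> V"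
  using mem N_V' N_V by blast+

lemma not_mem: "a \<notin> N b" "b \<notin> N a" "c \<notin> N b" "b \<notin> N c" "v \<notin> N c"
proof -
  show 1: "a \<notin> N b" "b \<notin> N a" using no_triangle[OF deg2(1)] Nv by blast+
  show 2: "c \<notin> N b" using no_common2[OF deg2(1), of a b c] Nv Na ab vc N_sym[of b c] N_sym[of a c] by blast
  then show "b \<notin> N c" using N_sym by blast
  show "v \<notin> N c" using no_triangle[OF deg2(2)] Na by blast
qed

lemma dist: "b \<noteq> c" "v \<noteq> a" "v \<noteq> b" "a \<noteq> c" "c \<noteq> b1" "c \<noteq> b2" "b \<noteq> c1" "b \<noteq> c2" "a \<noteq> b1" "a \<noteq> b2" "v \<noteq> c1" "v \<noteq> c2"
    "b \<noteq> b1" "b \<noteq> b2" "c \<noteq> c1" "c \<noteq> c2"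
proof -
  show "b \<noteq> c" using not_mem Na by blast
  show "v \<noteq> a" "v \<noteq> b" "a \<noteq> c" "b \<noteq> b1" "b \<noteq> b2" "c \<noteq> c1" "c \<noteq> c2" using mem N_not_refl by metis+
  show "c \<noteq> b1" "c \<noteq> b2" "b \<noteq> c1" "b \<noteq> c2" "a \<noteq> b1" "a \<noteq> b2" "v \<noteq> c1" "v \<noteq> c2"
    using not_mem Nb Nc by blast+
qed

lemma not_mem2: "a \<notin> N b1" "a \<notin> N b2" "v \<notin> N c1" "v \<notin> N c2" "b1 \<notin> N a" "b2 \<notin> N a" "c1 \<notin> N v" "c2 \<notin> N v"
  "b1 \<notin> N v" "b2 \<notin> N v"
proof -
  show *: "b1 \<notin> N a" "b2 \<notin> N a" "c1 \<notin> N v" "c2 \<notin> N v" "b1 \<notin> N v" "b2 \<notin> N v"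
    using dist ne_b ne_c by (simp_all add: Nv Na)
  then show "a \<notin> N b1" "a \<notin> N b2" "v \<notin> N c1" "v \<notin> N c2" using N_sym by blast+
qed

lemma swap_va: "edge2 V N a v c b c1 c2 b1 b2"
  using Nv Na Nb Nc ab vc ne_b ne_c by unfold_locales auto

lemma swap_b: "edge2 V N v a b c b2 b1 c1 c2"
  using Nv Na Nb Nc ab vc ne_b ne_c by unfold_locales auto

lemma swap_c: "edge2 V N v a b c b1 b2 c2 c1"
  using Nv Na Nb Nc ab vc ne_b ne_c by unfold_locales auto

lemma M_v: "t \<noteq> v \<Longrightarrow> M v t = of_bool (t \<in> {c, b1, b2})"
  using M_eval2[OF Nv ab, of t] Na Nb dist by auto

lemma M_a: "t \<noteq> a \<Longrightarrow> M a t = of_bool (t \<in> {b, c1, c2})"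
  using M_eval2[OF Na vc, of t] Nv Nc dist by auto

lemma M_v_pos: "M v t \<ge> 1 \<Longrightarrow> t \<in> {v, c, b1, b2}"
  using M_v[of t] by (cases "t \<in> {c, b1, b2}") auto

lemma M_va: "M v v = 1" "M a a = 1" "M v a = 0" "M v b = 0" "M v c = 1" "M v b1 = 1" "M v b2 = 1"
  "M a b = 1" "M a c = 0" "M a c1 = 1" "M a c2 = 1"
  using M_v[of a] M_v[of b] M_v[of c] M_v[of b1] M_v[of b2] M_a[of b] M_a[of c] M_a[of c1] M_a[of c2]
    M_self2[OF deg2(1)] M_self2[OF deg2(2)] dist ab vc ne_b ne_c by simp_all

text \<open>A common neighbour of b and c would be v + a as a vector. Its products with b and c then
  make it adjacent to b2 and c2, which must coincide. So b and c are twins, although v has product 0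
  with b and 1 with c.\<close>

lemma b1_ne_c1: "b1 \<noteq> c1"
proof
  assume eq: "b1 = c1"
  have rel: "M b1 t = M v t + M a t" for t
    using M_kernel[of "[(1, b1), (-1, v), (-1, a)]" t] M_va eq M_self_le[of b1]
      M_commute[of b1 v] M_commute[of b1 a] M_commute[of a v] by simp
  have "b1 \<in> N b2" using M_posD[of b b1] rel[of b] M_va Nb M_commute[of b b1] not_mem2 N_irrefl[of b1] by auto
  moreover have "b1 \<in> N c2" using M_posD[of c b1] rel[of c] M_va Nc M_commute[of c b1] not_mem2 N_irrefl[of b1] eq by auto
  ultimately have u: "b2 \<in> N b1" "c2 \<in> N b1" using N_sym by blast+
  have "c \<in> N b1" using mem eq by simp
  then have "N b1 = {b, c, b2}" using N3I[OF mem(3) _ u(1)] dist by auto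
  then have "b2 = c2" using u dist by auto
  then have "M b c \<ge> 2" using M_common2[of b c b1 b2] Nb Nc eq dist ne_b by auto
  then have "M b v = M c v" using twin3[of b c v] in_V by blast
  then show False using M_va M_commute[of b v] M_commute[of c v] by simp
qed

lemma M_v_ab: "M b v = 0" "M c v = 1" "M b a = 1" "M c a = 0"
  using M_va M_commute[of b v] M_commute[of c v] M_commute[of b a] M_commute[of c a] by simp_all

lemma bs_ne_cs: "b1 \<noteq> c1" "b1 \<noteq> c2" "b2 \<noteq> c1" "b2 \<noteq> c2"
  using b1_ne_c1 edge2.b1_ne_c1[OF swap_b] edge2.b1_ne_c1[OF swap_c] edge2.b1_ne_c1[OF edge2.swap_b[OF swap_c]]
  by blast+

lemma bs_cs_not_mem: "b1 \<notin> N c" "b2 \<notin> N c" "c1 \<notin> N b" "c2 \<notin> N b" "c \<notin> N b1" "c \<notin> N b2" "b \<notin> N c1" "b \<notin> N c2"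
proof -
  show *: "b1 \<notin> N c" "b2 \<notin> N c" "c1 \<notin> N b" "c2 \<notin> N b"
    using Nb Nc bs_ne_cs not_mem2 dist ne_b ne_c mem(3) by auto
  then show "c \<notin> N b1" "c \<notin> N b2" "b \<notin> N c1" "b \<notin> N c2" using N_sym by blast+
qed

lemma M_bc: "M b c = 0"
  using M_eval3[OF Nb ne_b dist(1)] bs_cs_not_mem Nv dist vc by auto

end

section \<open>The hexagon v, a, c, c1, b1, b with b1 and c1 of degree 2\<close>

locale hexagon = edge2 +
  assumes Nb1: "N b1 = {b, c1}" and Nc1: "N c1 = {c, b1}"
begin

lemma hexagon_swap: "hexagon V N a v c b c1 c2 b1 b2"
  using swap_va Nb1 Nc1 by (simp add: hexagon_def hexagon_axioms_def)

text \<open>With degree 2, b2 would have the vector of v; this forces the edge from b2 to c2 and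
  closes the graph up with colour classes {v, b1, b2, c} and {a, b, c1, c2}.\<close>

lemma b2_deg3: "card (N b2) = 3"
proof (rule ccontr)
  assume "card (N b2) \<noteq> 3"
  then have b22: "card (N b2) = 2" using card_N_cases in_V by blast
  have twin: "M v t = M b2 t" for t using twin2[OF deg2(1) b22] M_va by simp
  then have "M c b2 = 1" using M_va M_commute[of c b2] by simp
  then have "b2 \<in> N c2" using M_posD[of c b2] Nc Nc1 not_mem2 dist ne_b by auto
  then have "c2 \<in> N b2" using N_sym by blast
  then have Nb2: "N b2 = {b, c2}" using N2I[OF b22 mem(4)] dist by blast
  have Nc2: "N c2 \<subseteq> {c, b2}"
  proof
    fix s assume s: "s \<in> N c2"
    have c2s: "c2 \<in> N s" using s N_sym by blast
    show "s \<in> {c, b2}"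
    proof (rule ccontr)
      assume n: "s \<notin> {c, b2}"
      have "M b2 s \<ge> 1" using M_common[of b2 s c2] \<open>c2 \<in> N b2\<close> c2s n by auto
      then have "M v s \<ge> 1" using twin by simp
      then have "s \<in> {v, b1}" using M_v_pos[of s] n by auto
      moreover have "c2 \<notin> N v" "c2 \<notin> N b1" using not_mem2 dist ne_c by (simp_all add: Nb1)
      ultimately show False using c2s by auto
    qed
  qed
  show False
  proof (rule bipartition_closed[of "{v, b1, b2, c}" "{a, b, c1, c2}" v])
    show "N u \<subseteq> {a, b, c1, c2}" if "u \<in> {v, b1, b2, c}" for u using that Nv Nb1 Nb2 Nc by auto
    show "N w \<subseteq> {v, b1, b2, c}" if "w \<in> {a, b, c1, c2}" for w using that Na Nb Nc1 Nc2 by auto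
  qed (use dist in_V in auto)
qed

text \<open>Without this edge b2 + c = 2v as vectors, but a walk of length 2 from b2 that avoids b
  and does not return ends outside {v, c, b1}.\<close>

lemma c2_b2: "c2 \<in> N b2"
proof (rule ccontr)
  assume n: "c2 \<notin> N b2"
  then have n': "b2 \<notin> N c2" using N_sym by blast
  have "b2 \<notin> N c1" using Nc1 dist ne_b by auto
  then have "M c b2 = 0" using M_eval3[OF Nc ne_c dist(6)] n' not_mem2 by simp
  then have opp: "M b2 t + M c t = 2 * M v t" for t
    using opposite(1)[OF deg2(1), of b2 c t] M_va M_commute[of b2 c] by simp
  obtain y z where yz: "N b2 = {b, y, z}" "b \<noteq> y" using N3E[OF b2_deg3 mem(4)] .
  have b2y: "b2 \<in> N y" using yz N_sym by blast
  obtain x where x: "x \<in> N y" "x \<noteq> b2" using N_other[OF b2y] .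
  have yx: "y \<in> N x" using x N_sym by blast
  have "M b2 x \<ge> 1" using M_common[of b2 x y] yz x yx by auto
  moreover have "M c x \<ge> 0" using M_nonneg_V in_V by blast
  ultimately have "M v x \<ge> 1" using opp[of x] by linarith
  then have "x \<in> {v, c, b1, b2}" by (rule M_v_pos)
  moreover have "y \<notin> N v" "y \<notin> N b1" using Nv Nb1 b2y not_mem2 yz(2) \<open>b2 \<notin> N c1\<close> by auto
  moreover have "y \<notin> N c" using Nc b2y not_mem2 \<open>b2 \<notin> N c1\<close> n' by auto
  ultimately show False using yx x by auto
qed

end

locale hexagon2 = hexagon +
  fixes s t
  assumes Nb2: "N b2 = {b, c2, s}" and Nc2: "N c2 = {c, b2, t}" and ne_st: "b \<noteq> s" "c2 \<noteq> s" "c \<noteq> t" "b2 \<noteq> t"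
begin

lemma hexagon2_swap: "hexagon2 V N a v c b c1 c2 b1 b2 t s"
  using hexagon_swap Nb2 Nc2 ne_st by (simp add: hexagon2_def hexagon2_axioms_def)

lemma b2s: "b2 \<in> N s"
  using Nb2 N_sym by blast

lemma s_ne: "s \<notin> {a, b, c1, c2, v, c}"
proof -
  have "b2 \<notin> N c1" using Nc1 dist ne_b by auto
  then show ?thesis using b2s not_mem2 bs_cs_not_mem ne_st by auto
qed

lemma M_s: "M s x = M b x + M c2 x - 2 * M a x"
proof -
  have "M b c2 = 1" using M_eval3[OF Nb ne_b dist(8)] not_mem2 Nb1 Nb2 dist ne_c by auto
  moreover have "M s a = 0" using M_a[of s] s_ne M_commute[of s a] by auto
  moreover have "M s b \<ge> 1" "M s c2 \<ge> 1" using M_common[of s b b2] M_common[of s c2 b2] b2s Nb Nc2 ne_st by auto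
  ultimately show ?thesis using third_root[OF deg2(2), of b c2 s x] M_va by simp
qed

lemma M_t: "M t x = M c x + M b2 x - 2 * M v x"
  using hexagon2.M_s[OF hexagon2_swap] .

lemma s_not_t: "s \<notin> N t"
proof
  assume st: "s \<in> N t"
  have "c2 \<in> N t" using Nc2 N_sym by blast
  then have "M t b2 \<ge> 2" using M_common2[of t b2 c2 s] st Nb2 ne_st by auto
  moreover have "M c b2 = 1" using M_eval3[OF Nc ne_c dist(6)] not_mem2 Nc1 Nc2 dist ne_b by auto
  moreover have "M b2 b2 \<le> 2" by (rule M_self_le)
  ultimately show False using M_t[of b2] M_va by simp
qed

text \<open>By s = b + c2 - 2a, a vertex two steps from s has positive product with b or c2. If it
  is new, it must be a neighbour of t, so beyond s the graph can only lead back to t.\<close>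

lemma N_nbr_s:
  assumes p: "p \<in> N s" "p \<noteq> b2"
  shows "N p \<subseteq> insert s (N t - {c2})"
proof
  fix m assume m: "m \<in> N p"
  have pm: "p \<in> N m" "s \<in> N p" using m p N_sym by blast+
  have "p \<noteq> v" "p \<noteq> c" "p \<noteq> b1" "p \<noteq> t"
    using pm(2) s_ne Nv Nc Nb1 p s_not_t by auto
  then have npm: "p \<notin> N a" "p \<notin> N b" "p \<notin> N c1" "p \<notin> N c2" using p(2) Na Nb Nc1 Nc2 by auto
  show "m \<in> insert s (N t - {c2})"
  proof (rule ccontr)
    assume n: "m \<notin> insert s (N t - {c2})"
    have "M s m \<ge> 1" using M_common[of s m p] p pm n by auto
    moreover have "M a m \<ge> 0" using M_nonneg_V in_V by blast
    ultimately have "M b m \<ge> 1 \<or> M c2 m \<ge> 1" using M_s[of m] by linarith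
    then have "m \<in> N v \<or> m \<in> N b1 \<or> m \<in> N b2 \<or> m \<in> N c \<or> m \<in> N t"
      using M_posD[of b m] M_posD[of c2 m] Nb Nc2 by auto
    then have "m \<in> {a, b, c1, c2}" using Nv Nb1 Nb2 Nc n by auto
    then show False using npm pm by auto
  qed
qed

text \<open>The remaining neighbours of s and t are put into the two colour classes without being
  named; \<open>N_nbr_s\<close> and its mirror image show that nothing lies beyond them.\<close>

lemma impossible_hexagon2: False
proof (rule bipartition_closed[of "{v, c, b1, b2, t} \<union> (N s - {b2})" "{a, b, c1, c2, s} \<union> (N t - {c2})" v])
  show "N u \<subseteq> {a, b, c1, c2, s} \<union> (N t - {c2})" if "u \<in> {v, c, b1, b2, t} \<union> (N s - {b2})" for u
    using that Nv Nc Nb1 Nb2 N_nbr_s[of u] by auto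
  show "N w \<subseteq> {v, c, b1, b2, t} \<union> (N s - {b2})" if "w \<in> {a, b, c1, c2, s} \<union> (N t - {c2})" for w
    using that Na Nb Nc1 Nc2 hexagon2.N_nbr_s[OF hexagon2_swap, of w] by auto
  have "t \<notin> N v" using hexagon2.s_ne[OF hexagon2_swap] Nv by auto
  then have "v \<notin> N t" using N_sym by blast
  then show "v \<notin> {a, b, c1, c2, s} \<union> (N t - {c2})" using s_ne dist by auto
qed (use in_V in auto)

end

lemma (in hexagon) impossible_hexagon: False
proof -
  have c2_deg3: "card (N c2) = 3" using hexagon.b2_deg3[OF hexagon_swap] .
  have "b2 \<in> N c2" using c2_b2 N_sym by blast
  then obtain s t where "N b2 = {b, c2, s}" "b \<noteq> s" "c2 \<noteq> s" "N c2 = {c, b2, t}" "c \<noteq> t" "b2 \<noteq> t"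
    using N3E2[OF b2_deg3 mem(4) c2_b2 dist(8)] N3E2[OF c2_deg3 mem(6) _ dist(6)] by metis
  then have "hexagon2 V N v a b c b1 b2 c1 c2 s t" by unfold_locales auto
  then show False by (rule hexagon2.impossible_hexagon2)
qed

context edge2
begin

text \<open>Here b1 has the vector of v, so a further neighbour of c1 could only be b2, which would
  put b1 on a 4-cycle. Hence c1 has degree 2 as well and a hexagon arises.\<close>

lemma b1_deg2_aux:
  assumes "card (N b1) = 2" "c1 \<in> N b1"
  shows False
proof -
  have Nb1: "N b1 = {b, c1}" using N2I[OF assms(1) mem(3) assms(2)] dist by blast
  have twin: "M v t = M b1 t" for t using twin2[OF deg2(1) assms(1)] M_va by simp
  have b1c1: "b1 \<in> N c1" using assms N_sym by blast
  have "N c1 = {c, b1}"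
  proof (rule ccontr)
    assume "N c1 \<noteq> {c, b1}"
    then obtain s where s: "s \<in> N c1" "s \<noteq> c" "s \<noteq> b1" using mem(5) b1c1 by blast
    have c1s: "c1 \<in> N s" using s N_sym by blast
    have "M b1 s \<ge> 1" using M_common[of b1 s c1] assms c1s s by auto
    then have "M v s \<ge> 1" using twin by simp
    then have "s \<in> {v, c, b1, b2}" by (rule M_v_pos)
    then have "s = b2" using s not_mem2 by auto
    then have "b2 = b1" using no_common2[OF assms(1), of b c1 b2] mem assms c1s dist by auto
    then show False using ne_b by simp
  qed
  then have "hexagon V N v a b c b1 b2 c1 c2" using Nb1 by unfold_locales
  then show False by (rule hexagon.impossible_hexagon)
qed

lemma b1_deg3: "card (N b1) = 3"
proof (rule ccontr)
  assume "card (N b1) \<noteq> 3"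
  then have b12: "card (N b1) = 2" using card_N_cases in_V by blast
  have "M v c = M b1 c" using twin2[OF deg2(1) b12] M_va by simp
  then have "b1 \<in> N c1 \<or> b1 \<in> N c2"
    using M_posD[of c b1] M_va M_commute[of b1 c] Nc not_mem2 by auto
  then have "c1 \<in> N b1 \<or> c2 \<in> N b1" using N_sym by blast
  then show False using b1_deg2_aux[OF b12] edge2.b1_deg2_aux[OF swap_c b12] by blast
qed

lemma deg3: "card (N b1) = 3" "card (N b2) = 3" "card (N c1) = 3" "card (N c2) = 3"
  using b1_deg3 edge2.b1_deg3[OF swap_b] edge2.b1_deg3[OF swap_va] edge2.b1_deg3[OF edge2.swap_b[OF swap_va]]
  by blast+

lemma deg3_bc: "card (N b) = 3" "card (N c) = 3"
  using Nb Nc ne_b ne_c by simp_all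

text \<open>An edge would give b1 = v + b - a as vectors. It follows that the third neighbour x of
  b1 is adjacent to b2 and c and is a twin of b; then the third neighbour of c has positive product
  with b but no walk to realise it.\<close>

lemma b1_b2_not_adj: "b1 \<notin> N b2"
proof
  assume adj: "b1 \<in> N b2"
  then have adj': "b2 \<in> N b1" using N_sym by blast
  have "b2 \<in> N b" using Nb by blast
  then have "M b1 b \<ge> 1" using M_common[of b1 b b2] adj' dist by auto
  moreover have "M b1 a = 0" using M_a[of b1] M_commute[of b1 a] dist bs_ne_cs by auto
  ultimately have rel: "M b1 t = M v t + M b t - M a t" for t
    using M_kernel[of "[(1, b1), (-1, v), (-1, b), (1, a)]" t] M_va M_v_ab M_self3 deg3 deg3_bc
      M_commute[of b1 v] M_commute[of b1 b] M_commute[of a v] M_commute[of a b1] by simp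
  have "M b b2 \<ge> 1" using M_common[of b b2 b1] Nb adj dist by auto
  moreover have "M a b2 = 0" using M_a[of b2] dist bs_ne_cs by auto
  ultimately have b12: "M b1 b2 \<ge> 2" using rel[of b2] M_va by simp
  obtain x where x: "N b1 = {b, b2, x}" "b \<noteq> x" "b2 \<noteq> x" using N3E2[OF deg3(1) mem(3) adj' dist(14)] .
  have "b2 \<in> N x" using b12 M_eval3[OF x(1) dist(14) x(2,3) ne_b(3)] N_irrefl[of b2] by (auto simp: of_bool_def split: if_splits)
  moreover have "b1 \<in> N x" using x N_sym by blast
  moreover have "M b1 c = 1" using rel[of c] M_va M_bc by simp
  then have "c \<in> N x" using M_posD[of b1 c] x(1) not_mem bs_cs_not_mem by auto
  ultimately have Nx: "N x = {c, b1, b2}" and bx: "x \<in> N b1" "x \<in> N b2" and xc: "x \<in> N c"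
    using N3I[of c x b1 b2] dist ne_b N_sym by blast+
  have xa: "x \<noteq> a" using bx not_mem2 by auto
  obtain e where e: "N c = {a, x, e}" "a \<noteq> e" "x \<noteq> e" using N3E2[OF deg3_bc(2) mem(2) xc] xa by blast
  have ec: "c \<in> N e" using e N_sym by blast
  have "M b x \<ge> 2" using M_common2[of b x b1 b2] Nb Nx x ne_b by auto
  then have "M b e = M x e" using twin3[of b x e] in_V N_V[OF xc] by blast
  moreover have "M x e \<ge> 1" using M_common[of x e c] Nx ec e by auto
  ultimately have "e \<in> N v \<or> e \<in> N b1 \<or> e \<in> N b2" using M_posD[of b e] Nb by auto
  moreover have "e \<noteq> b" "e \<noteq> b2" "e \<noteq> b1" using ec not_mem bs_cs_not_mem by auto
  moreover have "N b2 = {b, b1, x}" using N3I[OF mem(4) adj bx(2)] x dist calculation bx N_irrefl by metis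
  ultimately show False using e x Nv by auto
qed

text \<open>A second common neighbour y would make b1 and b2 twins and y a twin of b. Products with
  a and c then produce a third common neighbour e.\<close>

lemma M_b1_b2: "M b1 b2 = 1"
proof -
  have "M b1 b2 \<ge> 1" using M_common[of b1 b2 b] mem ne_b by auto
  moreover have "\<not> M b1 b2 \<ge> 2"
  proof
    assume 2: "M b1 b2 \<ge> 2"
    then have twin: "M b1 t = M b2 t" for t using twin3[of b1 b2 t] in_V by blast
    obtain p q where pq: "N b1 = {b, p, q}" "b \<noteq> p" "b \<noteq> q" "p \<noteq> q" using N3E[OF deg3(1) mem(3)] .
    have "b2 \<in> N p \<or> b2 \<in> N q" using 2 M_eval3[OF pq ne_b(3)] by (auto simp: of_bool_def split: if_splits)
    then obtain y where y: "y \<in> N b1" "b \<noteq> y" "b2 \<in> N y" using pq by auto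
    have by1: "b1 \<in> N y" "y \<in> N b2" using y N_sym by blast+
    have "M b y \<ge> 2" using M_common2[of b y b1 b2] Nb by1 y ne_b by auto
    then have twin_b: "M b t = M y t" for t using twin3[of b y t] in_V N_V[OF y(1)] by blast
    have "M a y \<ge> 1" using twin_b[of a] M_v_ab M_commute[of y a] by simp
    then have "y \<in> N v \<or> y \<in> N c" using M_posD[of a y] Na by auto
    moreover have ya: "y \<noteq> a" using y not_mem2 by auto
    ultimately have yc: "y \<in> N c" using Nv y by auto
    then have cy: "c \<in> N y" using N_sym by blast
    obtain e where e: "N c = {a, y, e}" "a \<noteq> e" "y \<noteq> e" using N3E2[OF deg3_bc(2) mem(2) yc] ya by blast
    have ec: "c \<in> N e" using e N_sym by blast
    have "M y e \<ge> 1" using M_common[of y e c] cy ec e by auto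
    then have "e \<in> N v \<or> e \<in> N b1 \<or> e \<in> N b2" using twin_b M_posD[of b e] Nb by auto
    moreover have eb: "e \<noteq> b" using ec not_mem by auto
    ultimately have "b1 \<in> N e \<or> b2 \<in> N e" using e Nv N_sym by auto
    moreover have "M c b1 = M c b2" using twin[of c] M_commute[of c b1] M_commute[of c b2] by simp
    then have "b1 \<in> N e \<longleftrightarrow> b2 \<in> N e"
      using M_eval3[OF e(1) _ e(2,3) dist(5)] M_eval3[OF e(1) _ e(2,3) dist(6)] ya not_mem2 by1 y by (simp add: of_bool_eq_iff)
    ultimately have "e \<in> N b1" "e \<in> N b2" using N_sym by blast+
    then show False using no_common3[of b b1 b2 y e] mem y by1 eb e ne_b by auto
  qed
  ultimately show ?thesis by simp
qed

text \<open>Product 2, through twins, and product 0, through an opposite pair over v, would each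
  give b1 and b2 a second common neighbour.\<close>

lemma M_c_b1: "M c b1 = 1"
proof -
  have "\<not> M c b1 \<ge> 2"
  proof
    assume 2: "M c b1 \<ge> 2"
    then have "M c b2 = M b1 b2" using twin3[of c b1 b2] in_V by blast
    then have "b2 \<in> N c1 \<or> b2 \<in> N c2" using M_b1_b2 M_posD[of c b2] Nc not_mem2 by auto
    moreover have "b1 \<in> N c1" "b1 \<in> N c2"
      using 2 M_eval3[OF Nc ne_c dist(5)] not_mem2 by (auto simp: of_bool_def split: if_splits)
    ultimately obtain e where e: "b1 \<in> N e" "b2 \<in> N e" "b \<noteq> e" using dist by blast
    have "e \<in> N b1" "e \<in> N b2" using e N_sym by blast+
    then have "M b1 b2 \<ge> 2" using M_common2[of b1 b2 b e] mem e ne_b by auto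
    then show False using M_b1_b2 by simp
  qed
  moreover have "M c b1 \<noteq> 0"
  proof
    assume 0: "M c b1 = 0"
    then have opp: "M b1 t + M c t = 2 * M v t" for t
      using opposite(1)[OF deg2(1), of b1 c t] M_va M_commute[of b1 c] by simp
    obtain y z where y: "N b1 = {b, y, z}" "b \<noteq> y" using N3E[OF deg3(1) mem(3)] .
    have b1y: "b1 \<in> N y" using y N_sym by blast
    obtain w where w: "w \<in> N y" "w \<noteq> b1" using N_other[OF b1y] .
    have yw: "y \<in> N w" using w N_sym by blast
    have "M b1 w \<ge> 1" using M_common[of b1 w y] y yw w by auto
    moreover have "M c w \<ge> 0" using M_nonneg_V in_V by blast
    ultimately have "M v w \<ge> 1" using opp[of w] by linarith
    then have "w \<in> {v, c, b1, b2}" by (rule M_v_pos)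
    moreover have "y \<noteq> a" using b1y not_mem2(5) by auto
    then have "y \<notin> N v" using y(2) by (simp add: Nv)
    then have "w \<noteq> v" using yw by auto
    moreover have "w \<noteq> c" using M_common[of c b1 y] 0 yw y dist by auto
    ultimately have "w = b2" using w by auto
    then have "M b1 b2 \<ge> 2" using M_common2[of b1 b2 b y] mem y yw ne_b by auto
    then show False using M_b1_b2 by simp
  qed
  moreover have "M c b1 \<ge> 0" using M_nonneg_V in_V by blast
  ultimately show ?thesis by linarith
qed

lemma M_cross: "M c b1 = 1" "M c b2 = 1" "M b c1 = 1" "M b c2 = 1" "M c1 c2 = 1" "c1 \<notin> N c2" "c2 \<notin> N c1"
  using M_c_b1 edge2.M_c_b1[OF swap_b] edge2.M_c_b1[OF swap_va] edge2.M_c_b1[OF edge2.swap_b[OF swap_va]]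
    edge2.M_b1_b2[OF swap_va] edge2.b1_b2_not_adj[OF swap_va] edge2.b1_b2_not_adj[OF edge2.swap_b[OF swap_va]]
  by blast+

text \<open>The four products in \<open>M_cross\<close> equal to 1 say that each of b1, b2 is
  adjacent to exactly one of c1, c2 and conversely.\<close>

lemma matching: "c1 \<in> N b1 \<and> c2 \<in> N b2 \<and> c1 \<notin> N b2 \<and> c2 \<notin> N b1 \<or> c2 \<in> N b1 \<and> c1 \<in> N b2 \<and> c2 \<notin> N b2 \<and> c1 \<notin> N b1"
  using M_eval3[OF Nb ne_b dist(7)] M_eval3[OF Nb ne_b dist(8)] M_eval3[OF Nc ne_c dist(5)] M_eval3[OF Nc ne_c dist(6)]
    M_cross not_mem2 N_sym[of b1] N_sym[of b2] by (simp add: of_bool_def split: if_splits)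

end

section \<open>The edges b1 c1 and b2 c2 and the third neighbours of their ends\<close>

locale edge_net = edge2 +
  fixes x1 x2 y1 y2
  assumes Nb1: "N b1 = {b, c1, x1}" and Nb2: "N b2 = {b, c2, x2}" and Nc1: "N c1 = {c, b1, y1}" and Nc2: "N c2 = {c, b2, y2}"
    and matched: "c1 \<notin> N b2" "c2 \<notin> N b1"
    and ne_net: "b \<noteq> x1" "c1 \<noteq> x1" "b \<noteq> x2" "c2 \<noteq> x2" "c \<noteq> y1" "b1 \<noteq> y1" "c \<noteq> y2" "b2 \<noteq> y2"
begin

lemma net_swap_va: "edge_net V N a v c b c1 c2 b1 b2 y1 y2 x1 x2"
proof -
  have "b1 \<notin> N c2" "b2 \<notin> N c1" using matched N_sym by blast+
  then show ?thesis using swap_va Nb1 Nb2 Nc1 Nc2 ne_net by (simp add: edge_net_def edge_net_axioms_def)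
qed

lemma net_swap_12: "edge_net V N v a b c b2 b1 c2 c1 x2 x1 y2 y1"
proof -
  have "edge2 V N v a b c b2 b1 c2 c1" by (rule edge2.swap_b[OF swap_c])
  then show ?thesis using Nb1 Nb2 Nc1 Nc2 matched ne_net by (simp add: edge_net_def edge_net_axioms_def)
qed

lemma x1_mem: "b1 \<in> N x1"
  using Nb1 N_sym by blast

lemma x1_notin: "x1 \<notin> {a, b, c, c1, c2, v, b2}"
proof -
  have "x1 \<in> N b1" using Nb1 by blast
  then have "x1 \<noteq> a" "x1 \<noteq> c" "x1 \<noteq> c2" "x1 \<noteq> b2"
    using not_mem2 bs_cs_not_mem matched b1_b2_not_adj N_sym[of b2 b1] by auto
  then show ?thesis using x1_mem not_mem2 ne_net by auto
qed

text \<open>The vectors a, b - a and c1 - a are orthonormal, and x1 is the sum of the last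
  two.\<close>

lemma M_x1: "M x1 t = M b t + M c1 t - 2 * M a t"
proof -
  have "M x1 a = 0" using M_a[of x1] x1_notin M_commute[of x1 a] by auto
  moreover have "M x1 b \<ge> 1" "M x1 c1 \<ge> 1"
    using M_common[of x1 b b1] M_common[of x1 c1 b1] x1_mem Nb Nc1 x1_notin by auto
  ultimately show ?thesis using third_root[OF deg2(2), of b c1 x1 t] M_cross M_va by simp
qed

lemma M_y1: "M y1 t = M c t + M b1 t - 2 * M v t"
  and M_y2: "M y2 t = M c t + M b2 t - 2 * M v t"
  using edge_net.M_x1[OF net_swap_va] edge_net.M_x1[OF edge_net.net_swap_va[OF net_swap_12]] by blast+

lemma c_not_mem_x1: "c1 \<notin> N x1" "c2 \<notin> N x1"
proof -
  have "M c1 c = 0" using M_eval3[OF Nc ne_c dist(15)] M_commute[of c c1] Na M_cross N_irrefl[of c1] dist by auto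
  then have "M x1 c = 0" using M_x1[of c] M_bc M_va by simp
  then show "c1 \<notin> N x1" "c2 \<notin> N x1"
    using M_common[of x1 c c1] M_common[of x1 c c2] x1_notin Nc by auto
qed

lemma y_mem: "c1 \<in> N y1" "c2 \<in> N y2"
  using Nc1 Nc2 N_sym by blast+

lemma x1_ne_y: "x1 \<noteq> y1" "x1 \<noteq> y2"
  using c_not_mem_x1 y_mem by blast+

lemma x1_not_adj: "x1 \<notin> N y1" "x1 \<notin> N y2" "x1 \<notin> N x2"
proof -
  have b1: "M b1 b1 = 2" using M_self3 deg3 by blast
  show "x1 \<notin> N y1"
  proof
    assume "x1 \<in> N y1"
    then have "M y1 b1 \<ge> 2" using M_common2[of y1 b1 c1 x1] y_mem Nb1 ne_net by auto
    then show False using M_y1[of b1] M_cross M_va b1 by simp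
  qed
  show "x1 \<notin> N y2"
  proof
    assume *: "x1 \<in> N y2"
    have "y2 \<noteq> b1" using y_mem matched by auto
    then have "M y2 b1 \<ge> 1" using M_common[of y2 b1 x1] * Nb1 by auto
    then show False using M_y2[of b1] M_cross M_va M_b1_b2 M_commute[of b2 b1] by simp
  qed
  show "x1 \<notin> N x2"
  proof
    assume "x1 \<in> N x2"
    then have x2: "x2 \<in> N x1" using N_sym by blast
    have "M x1 b2 \<ge> 1" using M_common[of x1 b2 x2] x2 Nb2 x1_notin by auto
    moreover have "M a b2 = 0" using M_a[of b2] dist bs_ne_cs by auto
    moreover have "M b b2 = 0"
      using M_eval3[OF Nb ne_b dist(14)] not_mem2 b1_b2_not_adj N_sym[of b2 b1] N_irrefl[of b2] by simp
    moreover have "M c1 b2 = 0"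
    proof (rule M_zero)
      show "c1 \<noteq> b2" using bs_ne_cs by simp
      show "z \<notin> N b2" if "z \<in> N c1" for z
        using that Nc1 bs_cs_not_mem b1_b2_not_adj Nb2 M_cross edge_net.x1_ne_y(2)[OF net_swap_va] 
          edge_net.x1_notin[OF net_swap_va] by auto
    qed
    ultimately show False using M_x1[of b2] by simp
  qed
qed

text \<open>By \<open>M_x1\<close>, a vertex two steps from x1 has positive product with b or c1;
  after removal of the known vertices this leaves only x1, x2 and neighbours of y1.\<close>

lemma N_nbr_x1:
  assumes p: "p \<in> N x1" "p \<noteq> b1"
  shows "N p \<subseteq> {x1, x2} \<union> (N y1 - {c1})"
proof
  fix m assume m: "m \<in> N p"
  have pm: "p \<in> N m" "x1 \<in> N p" using m p N_sym by blast+
  have "x2 \<noteq> x1" using edge_net.x1_mem[OF net_swap_12] pm M_b1_b2 M_common2[of b1 b2 b x1] Nb1 Nb2 ne_b ne_net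
    by auto
  then have "x1 \<notin> N v" "x1 \<notin> N c" "x1 \<notin> N b2" using x1_notin by (simp_all add: Nv Nc Nb2)
  then have "p \<noteq> v" "p \<noteq> c" "p \<noteq> b2" "p \<noteq> y1" "p \<noteq> y2" using pm(2) x1_not_adj by auto
  then have npm: "p \<notin> N a" "p \<notin> N b" "p \<notin> N c1" "p \<notin> N c2" using p(2) Na Nb Nc1 Nc2 by auto
  show "m \<in> {x1, x2} \<union> (N y1 - {c1})"
  proof (rule ccontr)
    assume n: "m \<notin> {x1, x2} \<union> (N y1 - {c1})"
    have "M x1 m \<ge> 1" using M_common[of x1 m p] p pm n by auto
    moreover have "M a m \<ge> 0" using M_nonneg_V in_V by blast
    ultimately have "M b m \<ge> 1 \<or> M c1 m \<ge> 1" using M_x1[of m] by linarith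
    then have "m \<in> N v \<or> m \<in> N b1 \<or> m \<in> N b2 \<or> m \<in> N c \<or> m \<in> N y1"
      using M_posD[of b m] M_posD[of c1 m] Nb Nc1 by auto
    then have "m \<in> {a, b, c1, c2}" using Nv Nb1 Nb2 Nc n by auto
    then show False using npm pm by auto
  qed
qed

lemma impossible_edge_net: False
proof (rule bipartition_closed[of "{v, c, b1, b2, y1, y2} \<union> (N x1 - {b1}) \<union> (N x2 - {b2})"
      "{a, b, c1, c2, x1, x2} \<union> (N y1 - {c1}) \<union> (N y2 - {c2})" v])
  show "N u \<subseteq> {a, b, c1, c2, x1, x2} \<union> (N y1 - {c1}) \<union> (N y2 - {c2})"
    if "u \<in> {v, c, b1, b2, y1, y2} \<union> (N x1 - {b1}) \<union> (N x2 - {b2})" for u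
    using that Nv Nc Nb1 Nb2 N_nbr_x1[of u] edge_net.N_nbr_x1[OF net_swap_12, of u] by auto
  show "N w \<subseteq> {v, c, b1, b2, y1, y2} \<union> (N x1 - {b1}) \<union> (N x2 - {b2})"
    if "w \<in> {a, b, c1, c2, x1, x2} \<union> (N y1 - {c1}) \<union> (N y2 - {c2})" for w
    using that Na Nb Nc1 Nc2 edge_net.N_nbr_x1[OF net_swap_va, of w]
      edge_net.N_nbr_x1[OF edge_net.net_swap_12[OF net_swap_va], of w] by auto
  have "y1 \<notin> N v" "y2 \<notin> N v"
    using edge_net.x1_notin[OF net_swap_va] edge_net.x1_notin[OF edge_net.net_swap_12[OF net_swap_va]] Nv by auto
  then have "v \<notin> N y1" "v \<notin> N y2" using N_sym by blast+
  then show "v \<notin> {a, b, c1, c2, x1, x2} \<union> (N y1 - {c1}) \<union> (N y2 - {c2})"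
    using dist x1_notin edge_net.x1_notin[OF net_swap_12] by auto
qed (use in_V in auto)

end

context edge2
begin

lemma impossible_matched:
  assumes "c1 \<in> N b1" "c2 \<in> N b2" "c1 \<notin> N b2" "c2 \<notin> N b1"
  shows False
proof -
  have b: "b1 \<in> N c1" "b2 \<in> N c2" using assms N_sym by blast+
  obtain x1 where 1: "N b1 = {b, c1, x1}" "b \<noteq> x1" "c1 \<noteq> x1" using N3E2[OF deg3(1) mem(3) assms(1) dist(7)] .
  obtain x2 where 2: "N b2 = {b, c2, x2}" "b \<noteq> x2" "c2 \<noteq> x2" using N3E2[OF deg3(2) mem(4) assms(2) dist(8)] .
  obtain y1 where 3: "N c1 = {c, b1, y1}" "c \<noteq> y1" "b1 \<noteq> y1" using N3E2[OF deg3(3) mem(5) b(1) dist(5)] .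
  obtain y2 where 4: "N c2 = {c, b2, y2}" "c \<noteq> y2" "b2 \<noteq> y2" using N3E2[OF deg3(4) mem(6) b(2) dist(6)] .
  have "edge_net V N v a b c b1 b2 c1 c2 x1 x2 y1 y2"
    using 1 2 3 4 assms by unfold_locales auto
  then show False by (rule edge_net.impossible_edge_net)
qed

end

lemma (in edge2) impossible_edge2: False
  using matching impossible_matched edge2.impossible_matched[OF swap_c] by blast

section \<open>Three consecutive vertices of degree 2\<close>

context triangle_free_gap_graph
begin

text \<open>Sharing q, the vertices p and r have the same vector, so each walk from p through x is
  matched by one from r through x', and x and x' agree in their neighbours beyond p and r. If x had
  degree 2, the graph would close up to a 6-cycle.\<close>

lemma path_of_deg2:
  assumes q: "N q = {p, r}" "p \<noteq> r" and p2: "card (N p) = 2" and r2: "card (N r) = 2"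
  obtains x x' y y' where "N p = {q, x}" "N r = {q, x'}" "N x = {p, y, y'}" "N x' = {r, y, y'}"
    "distinct [p, q, r, x, x', y, y']"
proof -
  have q2: "card (N q) = 2" using q by simp
  have qpr: "q \<in> N p" "q \<in> N r" using q N_sym by blast+
  have pr: "r \<notin> N p" "p \<notin> N r" using no_triangle[OF q2] q by blast+
  obtain x where x: "N p = {q, x}" "q \<noteq> x" using N2E[OF p2 qpr(1)] .
  obtain x' where x': "N r = {q, x'}" "q \<noteq> x'" using N2E[OF r2 qpr(2)] .
  have px: "p \<in> N x" "r \<in> N x'" using x x' N_sym by blast+
  have ne: "x \<noteq> r" "x' \<noteq> p" "x \<noteq> p" "x' \<noteq> r" using pr x x' px N_not_refl by auto
  have xx': "x \<noteq> x'" using no_common2[OF p2, of q x r] x x' q by auto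
  have xq: "x \<notin> N q" "x' \<notin> N q" using q ne by auto
  have xr: "x \<notin> N r" "x' \<notin> N p" using x x' xx' by auto
  have twin: "M p t = M r t" for t
    using twin2[OF p2 r2] M_common[of p r q] qpr q by auto
  have x3: "card (N x) = 3"
  proof (rule ccontr)
    assume "card (N x) \<noteq> 3"
    then have x2: "card (N x) = 2" using card_N_cases[of x] N_V'[OF px(1)] by blast
    obtain e where e: "N x = {p, e}" "p \<noteq> e" using N2E[OF x2 px(1)] .
    have xe: "x \<in> N e" using e N_sym by blast
    have er: "e \<noteq> r" using xe xr by auto
    have twin_q: "M q t = M x t" for t
      using twin2[OF q2 x2] M_common[of q x p] q px x by auto
    have "M q x' \<ge> 1" using M_common[of q x' r] q px x' by auto
    then have "x' \<in> N p \<or> x' \<in> N e" using twin_q M_posD[of x x'] e by auto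
    then have x'e: "x' \<in> N e" using xr by blast
    have Nx': "N x' \<subseteq> {r, e}"
    proof
      fix g assume g: "g \<in> N x'"
      have x'g: "x' \<in> N g" using g N_sym by blast
      show "g \<in> {r, e}"
      proof (rule ccontr)
        assume n: "g \<notin> {r, e}"
        have "M r g \<ge> 1" using M_common[of r g x'] x' x'g n by auto
        then have "g \<in> N q \<or> g \<in> N x" using twin M_posD[of p g] x by auto
        then have "g = p" using q e n by auto
        then show False using x'g xr by auto
      qed
    qed
    have Ne: "N e \<subseteq> {x, x'}"
    proof
      fix g assume g: "g \<in> N e"
      have eg: "e \<in> N g" using g N_sym by blast
      show "g \<in> {x, x'}"
      proof (rule ccontr)
        assume n: "g \<notin> {x, x'}"
        have "M x g \<ge> 1" using M_common[of x g e] e eg n by auto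
        then have "g \<in> N p \<or> g \<in> N r" using twin_q M_posD[of q g] q by auto
        then have "g = q" using x x' n by auto
        then show False using eg q e er by auto
      qed
    qed
    show False
    proof (rule bipartition_closed[of "{q, x, x'}" "{p, r, e}" q])
      show "N u \<subseteq> {p, r, e}" if "u \<in> {q, x, x'}" for u using that q e Nx' by auto
      show "N w \<subseteq> {q, x, x'}" if "w \<in> {p, r, e}" for w using that x x' Ne by auto
      have "q \<noteq> p" "q \<noteq> r" using qpr N_not_refl by auto
      moreover have "q \<noteq> e" using xe xq by auto
      ultimately show "q \<notin> {p, r, e}" by simp
    qed (use N_V'[of p q] q in auto)
  qed
  obtain y y' where y: "N x = {p, y, y'}" "p \<noteq> y" "p \<noteq> y'" "y \<noteq> y'" using N3E[OF x3 px(1)] .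
  have ymem: "x \<in> N y" "x \<in> N y'" using y N_sym by blast+
  have yx': "e \<in> N x'" if e: "e \<in> N x" "e \<noteq> p" for e
  proof -
    have xe: "x \<in> N e" using e N_sym by blast
    have "M p e \<ge> 1" using M_common[of p e x] x xe e by auto
    then have "e \<in> N q \<or> e \<in> N x'" using twin M_posD[of r e] x' by auto
    moreover have "e \<noteq> r" using xe xr by auto
    ultimately show ?thesis using q e by auto
  qed
  have y': "y \<in> N x'" "y' \<in> N x'" using yx' y by auto
  have yr: "r \<noteq> y" "r \<noteq> y'" using ymem xr by auto
  have Nx': "N x' = {r, y, y'}" using N3I[OF px(2) y' yr y(4)] .
  have "q \<noteq> y" "q \<noteq> y'" using ymem xq by auto
  moreover have "y \<noteq> x" "y' \<noteq> x" "y \<noteq> x'" "y' \<noteq> x'" using ymem y' N_not_refl by metis+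
  moreover have "p \<noteq> q" "q \<noteq> r" using qpr N_not_refl by metis+
  ultimately have "distinct [p, q, r, x, x', y, y']"
    using q x x' ne xx' y yr by simp
  then show ?thesis using that x x' y Nx' by blast
qed

text \<open>One step of the ladder: \<open>P\<close> is the part of the graph explored so far, in which only \<open>y\<close> and
  \<open>y'\<close> have unexplored neighbours; \<open>A\<close> and \<open>B\<close> are its colour classes.\<close>

lemma ladder_step:
  assumes inner: "\<And>w. \<lbrakk>w \<in> P; w \<noteq> y; w \<noteq> y'\<rbrakk> \<Longrightarrow> N w \<subseteq> P"
    and x: "x \<in> P" "x' \<in> P" "x \<noteq> x'" "x \<noteq> y" "x \<noteq> y'" "x' \<noteq> y" "x' \<noteq> y'"
    and y: "y \<in> P" "y' \<in> P" "y \<noteq> y'" "y' \<notin> N y"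
    and Nx: "N x = {y, y', u}" and Nx': "y \<in> N x'" "y' \<in> N x'"
    and u: "u \<in> P" "u \<noteq> y" "u \<noteq> y'" "u \<in> N s" and s: "s \<in> P" "s \<notin> {x, x', y, y'}"
    and only: "\<And>w. \<lbrakk>w \<in> P; w \<noteq> y; w \<noteq> y'; y \<in> N w \<or> y' \<in> N w\<rbrakk> \<Longrightarrow> w = x \<or> w = x'"
    and col: "P = A \<union> B" "A \<inter> B = {}" "x \<in> A" "x' \<in> A" "y \<in> B" "y' \<in> B"
      "\<And>w. w \<in> A \<Longrightarrow> N w \<subseteq> B" "\<And>w. \<lbrakk>w \<in> B; w \<noteq> y; w \<noteq> y'\<rbrakk> \<Longrightarrow> N w \<subseteq> A"
  obtains z z' w w' where "N y = {x, x', z}" "N y' = {x, x', z'}" "N z = {y, w, w'}" "N z' = {y', w, w'}"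
    "distinct [z, z', w, w']" "{z, z', w, w'} \<inter> P = {}"
proof -
  have xy: "x \<in> N y" "x \<in> N y'" "x' \<in> N y" "x' \<in> N y'" using Nx Nx' N_sym by blast+
  have yV: "y \<in> V" "y' \<in> V" using xy N_V' by blast+
  have Myy': "M y y' \<ge> 2" using M_common2[of y y' x x'] xy x y by auto
  have y3: "card (N y) = 3" "card (N y') = 3"
    using card3_of_common2[of y y'] card3_of_common2[of y' y] Myy' M_commute[of y y'] yV y by auto
  have twin: "M y t = M y' t" for t using twin3[OF Myy' yV] .
  obtain z where z: "N y = {x, x', z}" "x \<noteq> z" "x' \<noteq> z" using N3E2[OF y3(1) xy(1,3) x(3)] .
  obtain z' where z': "N y' = {x, x', z'}" "x \<noteq> z'" "x' \<noteq> z'" using N3E2[OF y3(2) xy(2,4) x(3)] .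
  have zz': "z \<noteq> z'" using no_common3[of x y y' x' z] z z' x y by auto
  have yz: "y \<in> N z" "y' \<in> N z'" using z z' N_sym by blast+
  have "z \<noteq> y" "z' \<noteq> y'" using yz N_not_refl by metis+
  moreover have "z \<noteq> y'" "z' \<noteq> y" using y z z' N_sym by blast+
  ultimately have zP: "z \<notin> P" "z' \<notin> P" using only[of z] only[of z'] yz z z' by blast+
  have zy: "z \<notin> N y'" "z' \<notin> N y" using z z' zz' by auto
  have out: "w \<notin> P" if w: "w \<in> N g" "g \<in> {z, z'}" "w \<noteq> y" "w \<noteq> y'" for w g
    using inner[of w] N_sym[of w g] w zP by blast
  \<comment> \<open>The vertices y and y' have the same vector, so the walk y, z, w needs a
    counterpart from y' to w; as w lies outside \<open>P\<close>, it can only pass through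
    z'.\<close>
  have Nz: "w \<notin> P \<and> w \<in> N z'" if w: "w \<in> N z" "w \<noteq> y" for w
  proof -
    have zw: "z \<in> N w" using w N_sym by blast
    then have "w \<noteq> y'" using zy by auto
    then have wP: "w \<notin> P" using out w by blast
    have "M y w \<ge> 1" using M_common[of y w z] z zw w by auto
    then have "w \<in> N x \<or> w \<in> N x' \<or> w \<in> N z'" using twin M_posD[of y' w] z' by auto
    then show ?thesis using wP inner[of x] inner[of x'] x by blast
  qed
  have Nz': "w \<notin> P \<and> w \<in> N z" if w: "w \<in> N z'" "w \<noteq> y'" for w
  proof -
    have zw: "z' \<in> N w" using w N_sym by blast
    then have "w \<noteq> y" using zy by auto
    then have wP: "w \<notin> P" using out w by blast
    have "M y' w \<ge> 1" using M_common[of y' w z'] z' zw w by auto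
    then have "w \<in> N x \<or> w \<in> N x' \<or> w \<in> N z" using twin M_posD[of y w] z by auto
    then show ?thesis using wP inner[of x] inner[of x'] x by blast
  qed
  have z3: "card (N z) = 3"
  proof (rule ccontr)
    assume "card (N z) \<noteq> 3"
    then have z2: "card (N z) = 2" using card_N_cases N_V'[OF yz(1)] by blast
    obtain w where w: "N z = {y, w}" "y \<noteq> w" using N2E[OF z2 yz(1)] .
    have wP: "w \<notin> P" "w \<in> N z'" using Nz[of w] w by auto
    have Nz'w: "N z' \<subseteq> {y', w}" using Nz' w zy(2) y N_sym[of z' y] by auto
    have zw: "z \<in> N w" "z' \<in> N w" using w wP N_sym by blast+
    show False
    proof (cases "N w \<subseteq> {z, z'}")
      case True
      show False
      proof (rule bipartition_closed[of "A \<union> {z, z'}" "B \<union> {w}" x])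
        show "N g \<subseteq> B \<union> {w}" if "g \<in> A \<union> {z, z'}" for g
          using that col(5,6) col(7)[of g] w Nz'w by auto
        show "N g \<subseteq> A \<union> {z, z'}" if "g \<in> B \<union> {w}" for g
          using that col(3,4) col(8)[of g] z z' True
            by (cases "g = y \<or> g = y'") auto
        show "x \<notin> B \<union> {w}" using col x wP by blast
        show "x \<in> V" using N_V[OF xy(1)] .
      qed (use col in blast)
    next
      case False
      then obtain t where t: "t \<in> N w" "t \<noteq> z" "t \<noteq> z'" by blast
      have wt: "w \<in> N t" using t N_sym by blast
      have "w \<noteq> z" "w \<noteq> z'" using zw N_not_refl by metis+
      then have "w \<notin> N y" "w \<notin> N y'" using z z' wP x by auto
      then have "t \<noteq> y" "t \<noteq> y'" using wt by auto
      then have tP: "t \<notin> P" using inner[of t] wt wP by blast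
      have "x \<noteq> z" using z by blast
      have "M z t \<ge> 1" using M_common[of z t w] w wt t by auto
      moreover have "M z x \<ge> 1" using M_common[of z x y] w Nx z by auto
      moreover have "M x t = 0"
      proof -
        have "\<not> M x t \<ge> 1"
        proof
          assume "M x t \<ge> 1"
          then have "t \<in> N y \<or> t \<in> N y' \<or> t \<in> N u" using M_posD[of x t] Nx by auto
          then show False using z z' t tP x inner[OF u(1,2,3)] by auto
        qed
        moreover have "M x t \<ge> 0" using M_nonneg_V N_V[OF xy(1)] by blast
        ultimately show ?thesis by linarith
      qed
      \<comment> \<open>From x + t = 2z as vectors a contradiction arises at s: it lies two steps
        inwards from x, but it is orthogonal to z, whose second neighbour w lies outside
        \<open>P\<close>.\<close>
      ultimately have "M x s + M t s = 2 * M z s" using opposite(1)[OF z2] by blast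
      moreover have "M x s \<ge> 1" using M_common[of x s u] Nx u s by auto
      moreover have "M t s \<ge> 0" using M_nonneg_V N_V'[OF wt] by blast
      moreover have "\<not> M z s \<ge> 1"
      proof
        assume "M z s \<ge> 1"
        then have "s \<in> N y \<or> s \<in> N w" using M_posD[of z s] w by auto
        moreover have "s \<notin> N y" using z s zP by auto
        moreover have "s \<notin> N w" using inner[of s] s wP N_sym[of s w] by blast
        ultimately show False by blast
      qed
      ultimately show False by linarith
    qed
  qed
  obtain w w' where w: "N z = {y, w, w'}" "y \<noteq> w" "y \<noteq> w'" "w \<noteq> w'" using N3E[OF z3 yz(1)] .
  have ww: "w \<notin> P" "w' \<notin> P" "w \<in> N z'" "w' \<in> N z'" using Nz[of w] Nz[of w'] w by auto
  have "y' \<noteq> w" "y' \<noteq> w'" using ww y by auto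
  then have "N z' = {y', w, w'}" using N3I[OF yz(2) ww(3,4)] w by blast
  moreover have "w \<noteq> z" "w' \<noteq> z" "w \<noteq> z'" "w' \<noteq> z'" using w ww N_not_refl by auto
  ultimately show ?thesis using that[of z z' w w'] z z' w ww zP zz' by auto
qed

end

text \<open>This is the one-sided infinite ladder. It agrees with \<open>HJ' n\<close> on the
  vertices of the latter except at \<open>Vy n\<close> and \<open>Vy' n\<close>, so one function
  serves for all n.\<close>

fun half_ladder_nbrs :: "hj_vertex \<Rightarrow> hj_vertex set" where
  "half_ladder_nbrs Vp = {Vx 1, Vq}"
| "half_ladder_nbrs Vq = {Vp, Vr}"
| "half_ladder_nbrs Vr = {Vq, Vx' 1}"
| "half_ladder_nbrs (Vx i) = {Vy i, Vy' i, if i = 1 then Vp else Vy (i - 1)}"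
| "half_ladder_nbrs (Vx' i) = {Vy i, Vy' i, if i = 1 then Vr else Vy' (i - 1)}"
| "half_ladder_nbrs (Vy i) = {Vx i, Vx' i, Vx (i + 1)}"
| "half_ladder_nbrs (Vy' i) = {Vx i, Vx' i, Vx' (i + 1)}"

text \<open>Proper 2-colouring of the infinite ladder, supplying the classes \<open>A\<close> and
  \<open>B\<close> of \<open>ladder_step\<close>. The closing edge of \<open>HJ' n\<close> joins
  equal colours.\<close>

fun half_ladder_colour :: "hj_vertex \<Rightarrow> bool" where
  "half_ladder_colour Vp = False"
| "half_ladder_colour Vq = True"
| "half_ladder_colour Vr = False"
| "half_ladder_colour (Vx i) = True"
| "half_ladder_colour (Vx' i) = True"
| "half_ladder_colour (Vy i) = False"
| "half_ladder_colour (Vy' i) = False"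

lemma half_ladder_colour_nbr: "k \<in> half_ladder_nbrs h \<Longrightarrow> half_ladder_colour k \<longleftrightarrow> \<not> half_ladder_colour h"
  by (cases h) (auto split: if_splits)

lemma pverts_HJ': "pverts (HJ' n) = {Vp, Vq, Vr} \<union> (\<Union>i\<in>{1..n}. {Vx i, Vx' i, Vy i, Vy' i})"
  by (auto simp: HJ'_def twisted_ladder_def)

lemma pverts_HJ'_Suc:
  "pverts (HJ' (Suc n)) = pverts (HJ' n) \<union> {Vx (Suc n), Vx' (Suc n), Vy (Suc n), Vy' (Suc n)}"
  by (auto simp: pverts_HJ' atLeastAtMostSuc_conv)

lemma half_ladder_nbrs_subset:
  assumes "h \<in> pverts (HJ' n)" "h \<noteq> Vy n" "h \<noteq> Vy' n" "n \<ge> 1"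
  shows "half_ladder_nbrs h \<subseteq> pverts (HJ' n)"
  using assms by (cases h) (auto simp: pverts_HJ')

lemma nbrs_HJ':
  assumes "h \<in> pverts (HJ' n)" "n \<ge> 1"
  shows "{k. (h, k) \<in> parcs (HJ' n)} =
    (if h = Vy n then {Vx n, Vx' n, Vy' n} else if h = Vy' n then {Vx n, Vx' n, Vy n} else half_ladder_nbrs h)"
  using assms
  by (cases h) (auto simp: HJ'_def twisted_ladder_def twisted_ladder_edges_def hj'_new_edges_def)

context triangle_free_gap_graph
begin

text \<open>Neighbourhoods are prescribed exactly except at the last two vertices, which may have
  unexplored neighbours; whether these two are adjacent is left open.\<close>

definition ladder_embedding :: "nat \<Rightarrow> (hj_vertex \<Rightarrow> 'a) \<Rightarrow> bool" where
  "ladder_embedding n \<phi> \<longleftrightarrow> inj_on \<phi> (pverts (HJ' n)) \<and>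
     (\<forall>h\<in>pverts (HJ' n) - {Vy n, Vy' n}. N (\<phi> h) = \<phi> ` half_ladder_nbrs h)"

lemma ladder_embedding_V:
  assumes "ladder_embedding n \<phi>" "n \<ge> 1" "h \<in> pverts (HJ' n)"
  shows "\<phi> h \<in> V"
proof (cases "h \<in> {Vy n, Vy' n}")
  case True
  have "Vx n \<in> pverts (HJ' n) - {Vy n, Vy' n}" using assms(2) by (auto simp: pverts_HJ')
  then have "N (\<phi> (Vx n)) = \<phi> ` half_ladder_nbrs (Vx n)" using assms(1) unfolding ladder_embedding_def by blast
  then have "\<phi> h \<in> N (\<phi> (Vx n))" using True by auto
  then show ?thesis by (rule N_V)
next
  case False
  then have "N (\<phi> h) = \<phi> ` half_ladder_nbrs h" using assms unfolding ladder_embedding_def by blast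
  then have "N (\<phi> h) \<noteq> {}" by (cases h) auto
  then show ?thesis using N_empty_iff by blast
qed

lemma ladder_embedding_Suc:
  assumes emb: "ladder_embedding n \<phi>" and n: "n \<ge> 1" and open_end: "\<phi> (Vy' n) \<notin> N (\<phi> (Vy n))"
  shows "\<exists>\<psi>. ladder_embedding (Suc n) \<psi>"
proof -
  let ?H = "pverts (HJ' n)" and ?L = half_ladder_nbrs
  let ?I = "?H - {Vy n, Vy' n}"
  have inj: "inj_on \<phi> ?H" and nbr: "\<And>h. h \<in> ?I \<Longrightarrow> N (\<phi> h) = \<phi> ` ?L h"
    using emb by (auto simp: ladder_embedding_def)
  have LH: "?L h \<subseteq> ?H" if "h \<in> ?I" for h using half_ladder_nbrs_subset[of h n] that n by blast
  have eq: "\<phi> h = \<phi> k \<longleftrightarrow> h = k" if "h \<in> ?H" "k \<in> ?H" for h k using inj that by (auto dest: inj_onD)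
  \<comment> \<open>\<open>pu\<close> is the neighbour of x_n on the previous rung and
    \<open>ps\<close> a neighbour of \<open>pu\<close> further inside; on the first rung they are p
    and q.\<close>
  define pu where "pu = (if n = 1 then Vp else Vy (n - 1))"
  define ps where "ps = (if n = 1 then Vq else Vx (n - 1))"
  have H: "Vx n \<in> ?I" "Vx' n \<in> ?I" "Vy n \<in> ?H" "Vy' n \<in> ?H" "pu \<in> ?I" "ps \<in> ?I"
    using n by (auto simp: pverts_HJ' pu_def ps_def)
  define A where "A = \<phi> ` {h \<in> ?H. half_ladder_colour h}"
  define B where "B = \<phi> ` {h \<in> ?H. \<not> half_ladder_colour h}"
  obtain z z' w w' where
    step: "N (\<phi> (Vy n)) = {\<phi> (Vx n), \<phi> (Vx' n), z}" "N (\<phi> (Vy' n)) = {\<phi> (Vx n), \<phi> (Vx' n), z'}"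
      "N z = {\<phi> (Vy n), w, w'}" "N z' = {\<phi> (Vy' n), w, w'}"
      "distinct [z, z', w, w']" "{z, z', w, w'} \<inter> \<phi> ` ?H = {}"
  proof (rule ladder_step[of "\<phi> ` ?H" "\<phi> (Vy n)" "\<phi> (Vy' n)" "\<phi> (Vx n)" "\<phi> (Vx' n)" "\<phi> pu" "\<phi> ps" A B])
    have I: "\<exists>h. g = \<phi> h \<and> h \<in> ?I" if "g \<in> \<phi> ` ?H" "g \<noteq> \<phi> (Vy n)" "g \<noteq> \<phi> (Vy' n)" for g
      using that by auto
    show "N g \<subseteq> \<phi> ` ?H" if "g \<in> \<phi> ` ?H" "g \<noteq> \<phi> (Vy n)" "g \<noteq> \<phi> (Vy' n)" for g
      using I[OF that] nbr LH by blast
    show "g = \<phi> (Vx n) \<or> g = \<phi> (Vx' n)"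
      if g: "g \<in> \<phi> ` ?H" "g \<noteq> \<phi> (Vy n)" "g \<noteq> \<phi> (Vy' n)" and "\<phi> (Vy n) \<in> N g \<or> \<phi> (Vy' n) \<in> N g" for g
    proof -
      obtain h where h: "g = \<phi> h" "h \<in> ?I" using I[OF g] by blast
      then have "\<phi> (Vy n) \<in> \<phi> ` ?L h \<or> \<phi> (Vy' n) \<in> \<phi> ` ?L h" using that nbr by auto
      then have "Vy n \<in> ?L h \<or> Vy' n \<in> ?L h" using LH[OF h(2)] inj H by (meson inj_on_image_mem_iff)
      then have "h = Vx n \<or> h = Vx' n \<or> h = Vx (n + 1) \<or> h = Vx' (n + 1)"
        by (cases h) (auto split: if_splits)
      moreover have "h \<noteq> Vx (n + 1)" "h \<noteq> Vx' (n + 1)" using h by (auto simp: pverts_HJ')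
      ultimately show ?thesis using h by blast
    qed
    show "\<phi> ` ?H = A \<union> B" by (auto simp: A_def B_def)
    show "A \<inter> B = {}" using eq by (auto simp: A_def B_def)
    show "N g \<subseteq> B" if g: "g \<in> A" for g
    proof -
      obtain h where h: "g = \<phi> h" "h \<in> ?H" "half_ladder_colour h" using g unfolding A_def by blast
      then have "h \<in> ?I" by auto
      then show ?thesis using nbr[of h] LH[of h] half_ladder_colour_nbr[of _ h] h by (auto simp: B_def)
    qed
    show "N g \<subseteq> A" if g: "g \<in> B" "g \<noteq> \<phi> (Vy n)" "g \<noteq> \<phi> (Vy' n)" for g
    proof -
      obtain h where h: "g = \<phi> h" "h \<in> ?H" "\<not> half_ladder_colour h" using g(1) unfolding B_def by blast
      then have "h \<in> ?I" using g by auto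
      then show ?thesis using nbr[of h] LH[of h] half_ladder_colour_nbr[of _ h] h by (auto simp: A_def)
    qed
    show "N (\<phi> (Vx n)) = {\<phi> (Vy n), \<phi> (Vy' n), \<phi> pu}" using nbr[OF H(1)] by (simp add: pu_def)
    show "\<phi> (Vy n) \<in> N (\<phi> (Vx' n))" "\<phi> (Vy' n) \<in> N (\<phi> (Vx' n))" using nbr[OF H(2)] by auto
    show "\<phi> pu \<in> N (\<phi> ps)" using nbr[OF H(6)] n by (auto simp: pu_def ps_def)
    show "\<phi> ps \<notin> {\<phi> (Vx n), \<phi> (Vx' n), \<phi> (Vy n), \<phi> (Vy' n)}"
      using eq H n by (auto simp: ps_def split: if_splits)
    show "\<phi> pu \<noteq> \<phi> (Vy n)" "\<phi> pu \<noteq> \<phi> (Vy' n)" using eq H by auto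
    show "\<phi> (Vy' n) \<notin> N (\<phi> (Vy n))" by (rule open_end)
    show "\<phi> (Vx n) \<in> A" "\<phi> (Vx' n) \<in> A" "\<phi> (Vy n) \<in> B" "\<phi> (Vy' n) \<in> B"
      using H by (auto simp: A_def B_def)
  qed (use eq H in \<open>auto\<close>)
  define \<psi> where "\<psi> = \<phi>(Vx (Suc n) := z, Vx' (Suc n) := z', Vy (Suc n) := w, Vy' (Suc n) := w')"
  have new: "Vx (Suc n) \<notin> ?H" "Vx' (Suc n) \<notin> ?H" "Vy (Suc n) \<notin> ?H" "Vy' (Suc n) \<notin> ?H"
    by (auto simp: pverts_HJ')
  have \<psi>_new: "\<psi> (Vx (Suc n)) = z" "\<psi> (Vx' (Suc n)) = z'" "\<psi> (Vy (Suc n)) = w" "\<psi> (Vy' (Suc n)) = w'"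
    by (simp_all add: \<psi>_def)
  have \<psi>_old: "\<psi> h = \<phi> h" if "h \<in> ?H" for h
    using that new by (auto simp: \<psi>_def)
  have image: "\<psi> ` S = \<phi> ` S" if "S \<subseteq> ?H" for S
    using that \<psi>_old by (intro image_cong) auto
  have "inj_on \<psi> (?H \<union> {Vx (Suc n), Vx' (Suc n), Vy (Suc n), Vy' (Suc n)})"
  proof (subst inj_on_Un, intro conjI)
    show "inj_on \<psi> ?H" using inj \<psi>_old inj_on_cong[of ?H \<psi> \<phi>] by blast
    show "inj_on \<psi> {Vx (Suc n), Vx' (Suc n), Vy (Suc n), Vy' (Suc n)}"
      using step(5) by (auto simp: inj_on_def \<psi>_new)
    show "\<psi> ` (?H - {Vx (Suc n), Vx' (Suc n), Vy (Suc n), Vy' (Suc n)}) \<inter>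
        \<psi> ` ({Vx (Suc n), Vx' (Suc n), Vy (Suc n), Vy' (Suc n)} - ?H) = {}"
      using step(6) image[of "?H - {Vx (Suc n), Vx' (Suc n), Vy (Suc n), Vy' (Suc n)}"] by (auto simp: \<psi>_new)
  qed
  moreover have "N (\<psi> h) = \<psi> ` ?L h" if h: "h \<in> pverts (HJ' (Suc n)) - {Vy (Suc n), Vy' (Suc n)}" for h
  proof -
    consider "h \<in> ?I" | "h = Vy n" | "h = Vy' n" | "h = Vx (Suc n)" | "h = Vx' (Suc n)"
      using h by (auto simp: pverts_HJ'_Suc)
    then show ?thesis
    proof cases
      case 1
      then show ?thesis using nbr[of h] image[OF LH[OF 1]] \<psi>_old[of h] by simp
    qed (use step H n in \<open>auto simp: \<psi>_new \<psi>_old\<close>)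
  qed
  ultimately show ?thesis by (auto simp: ladder_embedding_def pverts_HJ'_Suc)
qed

text \<open>Otherwise \<open>ladder_embedding_Suc\<close> applies forever, and a ladder with more
  than \<open>card V\<close> rungs does not fit injectively into \<open>V\<close>.\<close>

lemma ladder_closes:
  assumes emb: "ladder_embedding 1 \<phi>"
  shows "\<exists>n \<psi>. n \<ge> 1 \<and> ladder_embedding n \<psi> \<and> \<psi> (Vy' n) \<in> N (\<psi> (Vy n))"
proof (rule ccontr)
  assume *: "\<not> ?thesis"
  have "\<exists>\<psi>. ladder_embedding (Suc n) \<psi>" for n
  proof (induction n)
    case 0
    then show ?case using emb by auto
  next
    case (Suc n)
    then show ?case using ladder_embedding_Suc * by (metis le_add1 plus_1_eq_Suc)
  qed
  then obtain \<psi> where \<psi>: "ladder_embedding (Suc (card V)) \<psi>" by blast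
  let ?X = "Vx ` {1..Suc (card V)}"
  have X: "?X \<subseteq> pverts (HJ' (Suc (card V)))" by (auto simp: pverts_HJ')
  have "inj_on \<psi> ?X" using \<psi> X by (auto simp: ladder_embedding_def intro: inj_on_subset)
  moreover have "\<psi> ` ?X \<subseteq> V" using ladder_embedding_V[OF \<psi>] X by auto
  ultimately have "card ?X \<le> card V" using card_inj_on_le finite_V by blast
  moreover have "card ?X = Suc (card V)" by (subst card_image) (auto simp: inj_on_def)
  ultimately show False by simp
qed

text \<open>Once the images of y_n and y_n' are adjacent, the degree bound fixes their
  neighbourhoods. The image is then closed under neighbours and by connectedness is all of
  \<open>V\<close>.\<close>

lemma ladder_isomorphism:
  assumes q: "N q = {p, r}" "p \<noteq> r" and p2: "card (N p) = 2" and r2: "card (N r) = 2"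
  shows "\<exists>n \<phi>. n \<ge> 1 \<and> bij_betw \<phi> (pverts (HJ' n)) V \<and>
    (\<forall>h\<in>pverts (HJ' n). N (\<phi> h) = \<phi> ` {k. (h, k) \<in> parcs (HJ' n)})"
proof -
  obtain x x' y y' where xy: "N p = {q, x}" "N r = {q, x'}" "N x = {p, y, y'}" "N x' = {r, y, y'}"
    "distinct [p, q, r, x, x', y, y']" using path_of_deg2[OF assms] .
  \<comment> \<open>Only the index 1 occurs in \<open>HJ' 1\<close>, so it may be ignored.\<close>
  define \<phi> where "\<phi> h = (case h of Vp \<Rightarrow> p | Vq \<Rightarrow> q | Vr \<Rightarrow> r | Vx _ \<Rightarrow> x | Vx' _ \<Rightarrow> x' | Vy _ \<Rightarrow> y | Vy' _ \<Rightarrow> y')" for h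
  have "ladder_embedding 1 \<phi>"
    unfolding ladder_embedding_def
  proof (intro conjI ballI)
    have 1: "pverts (HJ' 1) = {Vp, Vq, Vr, Vx 1, Vx' 1, Vy 1, Vy' 1}" by (auto simp: pverts_HJ')
    show "inj_on \<phi> (pverts (HJ' 1))" unfolding 1 inj_on_def using xy(5) by (auto simp: \<phi>_def)
    show "N (\<phi> h) = \<phi> ` half_ladder_nbrs h" if "h \<in> pverts (HJ' 1) - {Vy 1, Vy' 1}" for h
      using that q xy unfolding 1 by (auto simp: \<phi>_def)
  qed
  then obtain n \<psi> where n: "n \<ge> 1" and emb: "ladder_embedding n \<psi>" and close: "\<psi> (Vy' n) \<in> N (\<psi> (Vy n))"
    using ladder_closes by blast
  let ?H = "pverts (HJ' n)"
  have inj: "inj_on \<psi> ?H" and nbr: "\<And>h. h \<in> ?H - {Vy n, Vy' n} \<Longrightarrow> N (\<psi> h) = \<psi> ` half_ladder_nbrs h"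
    using emb by (auto simp: ladder_embedding_def)
  have H: "Vx n \<in> ?H" "Vx' n \<in> ?H" "Vy n \<in> ?H" "Vy' n \<in> ?H" using n by (auto simp: pverts_HJ')
  have ne: "\<psi> (Vx n) \<noteq> \<psi> (Vx' n)" "\<psi> (Vx n) \<noteq> \<psi> (Vy n)" "\<psi> (Vx n) \<noteq> \<psi> (Vy' n)" "\<psi> (Vx' n) \<noteq> \<psi> (Vy n)"
    "\<psi> (Vx' n) \<noteq> \<psi> (Vy' n)" using inj H by (auto dest: inj_onD)
  have "\<psi> (Vy n) \<in> N (\<psi> (Vx n))" "\<psi> (Vy n) \<in> N (\<psi> (Vx' n))" "\<psi> (Vy' n) \<in> N (\<psi> (Vx n))" "\<psi> (Vy' n) \<in> N (\<psi> (Vx' n))"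
    using nbr[of "Vx n"] nbr[of "Vx' n"] H by auto
  then have e: "\<psi> (Vx n) \<in> N (\<psi> (Vy n))" "\<psi> (Vx' n) \<in> N (\<psi> (Vy n))" "\<psi> (Vx n) \<in> N (\<psi> (Vy' n))" "\<psi> (Vx' n) \<in> N (\<psi> (Vy' n))"
    using N_sym by blast+
  have close': "\<psi> (Vy n) \<in> N (\<psi> (Vy' n))" using close N_sym by blast
  have "N (\<psi> (Vy n)) = {\<psi> (Vx n), \<psi> (Vx' n), \<psi> (Vy' n)}" using N3I[OF e(1,2) close] ne by blast
  moreover have "N (\<psi> (Vy' n)) = {\<psi> (Vx n), \<psi> (Vx' n), \<psi> (Vy n)}" using N3I[OF e(3,4) close'] ne by blast
  ultimately have all: "N (\<psi> h) = \<psi> ` {k. (h, k) \<in> parcs (HJ' n)}" if "h \<in> ?H" for h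
    using nbr[of h] nbrs_HJ'[OF that n] that by auto
  have closed: "{k. (h, k) \<in> parcs (HJ' n)} \<subseteq> ?H" if "h \<in> ?H" for h
    using nbrs_HJ'[OF that n] half_ladder_nbrs_subset[OF that _ _ n] H by auto
  have "\<psi> ` ?H = V"
  proof (rule connected)
    show "\<psi> ` ?H \<subseteq> V" using ladder_embedding_V[OF emb n] by blast
    show "\<psi> ` ?H \<noteq> {}" using H by blast
    show "N u \<subseteq> \<psi> ` ?H" if "u \<in> \<psi> ` ?H" for u using that all closed by blast
  qed
  then have "bij_betw \<psi> ?H V" using inj by (simp add: bij_betw_def)
  then show ?thesis using n all by blast
qed

lemma deg2_nbrs_isomorphism:
  assumes q: "card (N q) = 2"
  shows "\<exists>n \<phi>. n \<ge> 1 \<and> bij_betw \<phi> (pverts (HJ' n)) V \<and>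
    (\<forall>h\<in>pverts (HJ' n). N (\<phi> h) = \<phi> ` {k. (h, k) \<in> parcs (HJ' n)})"
proof -
  \<comment> \<open>An edge between vertices of degree 2 either extends at one end to three
    consecutive ones or has both outer neighbours of degree 3, which \<open>edge2\<close>
    excludes.\<close>
  have edge: ?thesis if v: "N v = {a, b}" "a \<noteq> b" and a2: "card (N a) = 2" for v a b
  proof (cases "card (N b) = 2")
    case True
    then show ?thesis using ladder_isomorphism[OF v a2] by blast
  next
    case False
    have mem: "v \<in> N a" "v \<in> N b" using v N_sym by blast+
    then have b3: "card (N b) = 3" using False card_N_cases N_V' by blast
    obtain c where c: "N a = {v, c}" "v \<noteq> c" using N2E[OF a2 mem(1)] .
    have ac: "a \<in> N c" using c N_sym by blast
    have v2: "card (N v) = 2" using v by simp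
    show ?thesis
    proof (cases "card (N c) = 2")
      case True
      then show ?thesis using ladder_isomorphism[OF c v2] by blast
    next
      case False
      then have c3: "card (N c) = 3" using card_N_cases N_V'[OF ac] by blast
      obtain b1 b2 where b: "N b = {v, b1, b2}" "v \<noteq> b1" "v \<noteq> b2" "b1 \<noteq> b2" using N3E[OF b3 mem(2)] .
      obtain c1 c2 where c': "N c = {a, c1, c2}" "a \<noteq> c1" "a \<noteq> c2" "c1 \<noteq> c2" using N3E[OF c3 ac] .
      have "edge2 V N v a b c b1 b2 c1 c2" using v c b c' by unfold_locales auto
      then have False by (rule edge2.impossible_edge2)
      then show ?thesis ..
    qed
  qed
  have "q \<in> V" using q N_empty_iff[of q] by auto
  obtain a b where v: "N q = {a, b}" "a \<noteq> b" using q by (auto simp: card_2_iff)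
  have mem: "q \<in> N a" "q \<in> N b" using v N_sym by blast+
  show ?thesis
  proof (cases "card (N a) = 2 \<or> card (N b) = 2")
    case True
    moreover have "N q = {b, a}" using v by blast
    ultimately show ?thesis using edge[OF v] edge[of q b a] v(2) by blast
  next
    case False
    then have d3: "card (N a) = 3" "card (N b) = 3" using card_N_cases mem N_V' by blast+
    obtain c c' where c: "N a = {q, c, c'}" "q \<noteq> c" "q \<noteq> c'" "c \<noteq> c'" using N3E[OF d3(1) mem(1)] .
    obtain d d' where d: "N b = {q, d, d'}" "q \<noteq> d" "q \<noteq> d'" "d \<noteq> d'" using N3E[OF d3(2) mem(2)] .
    have "fork V N q a b c c' d d'" using v c d by unfold_locales auto
    then have False by (rule fork.impossible_fork)
    then show ?thesis ..
  qed
qed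

end

section \<open>The classification\<close>

lemma digraph_iso_pairI:
  assumes G: "pair_wf_digraph G" and bij: "bij_betw f (pverts G) (pverts G')"
    and arcs: "parcs G' = map_prod f f ` parcs G"
  shows "digraph_iso (with_proj G) (with_proj G')"
proof -
  interpret pair_wf_digraph G by (rule G)
  define h where "h = \<lparr>iso_verts = f, iso_arcs = map_prod f f, iso_head = snd, iso_tail = fst\<rparr>"
  have inj: "inj_on f (pverts G)" using bij by (rule bij_betw_imp_inj_on)
  have sub: "parcs G \<subseteq> pverts G \<times> pverts G" using in_arcsD1 in_arcsD2 by auto
  have "inj_on (map_prod f f) (parcs G)"
    by (rule inj_on_subset[OF map_prod_inj_on[OF inj inj] sub])
  then have "digraph_isomorphism h"
    using inj wf_digraph_axioms by (simp add: digraph_isomorphism_def h_def)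
  moreover have "with_proj G' = app_iso h (with_proj G)"
    using bij_betw_imp_surj_on[OF bij] arcs by (simp add: app_iso_def h_def with_proj_def)
  ultimately show ?thesis unfolding digraph_iso_def by blast
qed

lemma connected_closed_set:
  assumes "Digraph_Component.connected (with_proj H)" "S \<subseteq> pverts H" "S \<noteq> {}"
    and closed: "\<And>u w. u \<in> S \<Longrightarrow> (u, w) \<in> parcs H \<or> (w, u) \<in> parcs H \<Longrightarrow> w \<in> S"
  shows "S = pverts H"
proof -
  obtain s where s: "s \<in> S" using assms(3) by blast
  have "t \<in> S" if "t \<in> pverts H" for t
  proof -
    have "(s, t) \<in> rtrancl_on (pverts H) ((parcs H)\<^sup>s)"
      using assms(1,2) s that by (auto simp: connected_conv)
    then show ?thesis
      by (induction rule: rtrancl_on_induct) (use s closed in \<open>auto simp: symcl_def\<close>)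
  qed
  then show ?thesis using assms(2) by blast
qed

theorem theorem2p15:
  fixes H :: "'a pair_pre_digraph"
  assumes "pair_graph H"
    and "Digraph_Component.connected (with_proj H)"
    and "\<not> bipartite H"
    and "max_degree H \<le> 3"
    and "min_degree H = 2"
    and "\<not> (\<exists>k. adjacency_eigenvalue H k \<and> k \<in> {-1<..<1})"
  shows "complete_digraph 3 (with_proj H) \<or>
         (\<exists>n\<ge>1. digraph_iso (with_proj H) (with_proj (HJ' n)))"
proof -
  interpret pair_graph H by (rule assms(1))
  define V where "V = pverts H"
  define N where "N u = {w. (u, w) \<in> parcs H}" for u
  have finV: "finite V" by (simp add: V_def pair_finite_verts)
  have NV: "N u \<subseteq> V" for u using in_arcsD2 by (auto simp: N_def V_def)
  have sym: "(u, w) \<in> parcs H \<longleftrightarrow> (w, u) \<in> parcs H" for u w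
    using pair_sym_arcs by (auto simp: symmetric_def dest: symD)
  have Nsym: "u \<in> N w \<longleftrightarrow> w \<in> N u" for u w using sym by (auto simp: N_def)
  have irr: "u \<notin> N u" for u using pair_no_loops[of "(u, u)"] by (auto simp: N_def)
  have deg: "out_degree (with_proj H) u = card (N u)" for u
  proof -
    have "out_arcs (with_proj H) u = Pair u ` N u" by (auto simp: out_arcs_def N_def)
    then show ?thesis by (simp add: out_degree_def card_image inj_on_def)
  qed
  have V0: "V \<noteq> {}" using assms(2) by (simp add: connected_conv V_def)
  have ge2: "2 \<le> card (N u)" if "u \<in> V" for u
  proof -
    have "Min ((\<lambda>u. card (N u)) ` V) \<le> card (N u)" using finV that by (intro Min_le) auto
    then show ?thesis using assms(5) by (simp add: min_degree_def deg V_def[symmetric])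
  qed
  have le3: "card (N u) \<le> 3" for u
  proof (cases "u \<in> V")
    case True
    then have "card (N u) \<le> Max ((\<lambda>u. card (N u)) ` V)" using finV by (intro Max_ge) auto
    then show ?thesis using assms(4) by (simp add: max_degree_def deg V_def[symmetric])
  next
    case False
    then have "N u = {}" using in_arcsD1 by (auto simp: N_def V_def)
    then show ?thesis by simp
  qed
  obtain q where q: "q \<in> V" "card (N q) = 2"
  proof -
    have "Min ((\<lambda>u. card (N u)) ` V) \<in> (\<lambda>u. card (N u)) ` V" using finV V0 by (intro Min_in) auto
    then show ?thesis using that assms(5) by (auto simp: min_degree_def deg V_def[symmetric])
  qed
  have Nset: "{w. w \<in> pverts H \<and> (u, w) \<in> parcs H} = N u" for u
    using in_arcsD2 by (auto simp: N_def)
  interpret gap_graph V N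
  proof
    show "nbr_form V N 1 f f \<ge> 0" for f
    proof (rule nbr_form_nonneg[OF finV NV Nsym])
      fix k :: real and g
      assume k: "-1 < k" "k < 1" and g: "\<And>u. u \<in> V \<Longrightarrow> sum g (N u) = k * g u"
      have "\<not> adjacency_eigenvalue H k" using assms(6) k by auto
      then show "\<forall>v\<in>V. g v = 0"
        using g by (auto simp: adjacency_eigenvalue_iff[OF pair_finite_verts] Nset V_def)
    qed
    show "S = V" if "S \<subseteq> V" "S \<noteq> {}" "\<And>u. u \<in> S \<Longrightarrow> N u \<subseteq> S" for S
      unfolding V_def
      by (rule connected_closed_set[OF assms(2)]) (use that sym in \<open>auto simp: V_def N_def\<close>)
    show False if UW: "U \<union> W = V" "U \<inter> W = {}" and U: "\<And>u. u \<in> U \<Longrightarrow> N u \<subseteq> W" and W: "\<And>w. w \<in> W \<Longrightarrow> N w \<subseteq> U"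
      for U W
    proof -
      have "parcs H \<subseteq> U \<times> W \<union> W \<times> U"
      proof
        fix e assume "e \<in> parcs H"
        moreover obtain u w where "e = (u, w)" by (cases e)
        ultimately have "u \<in> V" "w \<in> N u" "e = (u, w)" using in_arcsD1 by (auto simp: V_def N_def)
        then show "e \<in> U \<times> W \<union> W \<times> U" using UW(1) U W by blast
      qed
      then have "bipartite H" using UW unfolding bipartite_def V_def by blast
      then show False using assms(3) by blast
    qed
  qed (use finV NV Nsym irr ge2 le3 in auto)
  show ?thesis
  proof (cases "\<exists>v a b. card (N v) = 2 \<and> a \<in> N v \<and> b \<in> N v \<and> b \<in> N a")
    case True
    then obtain v a b where vab: "card (N v) = 2" "a \<in> N v" "b \<in> N v" "b \<in> N a" by blast
    then have ab: "a \<noteq> b" using irr by blast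
    have Nv: "N v = {a, b}" using N2I[OF vab(1-3) ab] .
    note tri = triangle[OF Nv ab vab(4)]
    have ne: "v \<noteq> a" "v \<noteq> b" using vab irr by blast+
    have "(u, w) \<in> parcs H \<longleftrightarrow> u \<in> V \<and> w \<in> V \<and> u \<noteq> w" for u w
    proof
      assume uw: "(u, w) \<in> parcs H"
      then show "u \<in> V \<and> w \<in> V \<and> u \<noteq> w" using in_arcsD1 in_arcsD2 irr[of u] by (auto simp: V_def N_def)
    next
      assume "u \<in> V \<and> w \<in> V \<and> u \<noteq> w"
      then have "w \<in> N u" using tri Nv ne ab by auto
      then show "(u, w) \<in> parcs H" by (simp add: N_def)
    qed
    then have "parcs H = {(u, w). (u, w) \<in> V \<times> V \<and> u \<noteq> w}" by auto
    moreover have "card V = 3" using tri(1) ne ab by simp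
    ultimately have "complete_digraph 3 (with_proj H)"
      using finV by (simp add: complete_digraph_pair_def V_def)
    then show ?thesis ..
  next
    case False
    interpret triangle_free_gap_graph V N by unfold_locales (use False in blast)
    obtain n \<phi> where n: "n \<ge> 1" and bij: "bij_betw \<phi> (pverts (HJ' n)) V"
      and nbr: "\<And>h. h \<in> pverts (HJ' n) \<Longrightarrow> N (\<phi> h) = \<phi> ` {k. (h, k) \<in> parcs (HJ' n)}"
      using deg2_nbrs_isomorphism[OF q(2)] by blast
    \<comment> \<open>The embedding runs from the ladder into the graph, whereas the required
      isomorphism starts at \<open>H\<close>.\<close>
    let ?\<psi> = "inv_into (pverts (HJ' n)) \<phi>"
    have inv: "?\<psi> (\<phi> h) = h" if "h \<in> pverts (HJ' n)" for h
      using bij_betw_inv_into_left[OF bij that] .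
    have arc_verts: "h \<in> pverts (HJ' n) \<and> k \<in> pverts (HJ' n)" if "(h, k) \<in> parcs (HJ' n)" for h k
      using that n
      by (auto simp: HJ'_def twisted_ladder_def twisted_ladder_edges_def hj'_new_edges_def)
    have "parcs (HJ' n) = map_prod ?\<psi> ?\<psi> ` parcs H"
    proof (intro equalityI subsetI)
      fix e assume e: "e \<in> parcs (HJ' n)"
      obtain h k where hk: "e = (h, k)" by (cases e)
      then have v: "h \<in> pverts (HJ' n)" "k \<in> pverts (HJ' n)" using e arc_verts by blast+
      have "\<phi> k \<in> N (\<phi> h)" using nbr[OF v(1)] e hk by blast
      then have "(\<phi> h, \<phi> k) \<in> parcs H" by (simp add: N_def)
      moreover have "e = map_prod ?\<psi> ?\<psi> (\<phi> h, \<phi> k)" using hk inv v by simp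
      ultimately show "e \<in> map_prod ?\<psi> ?\<psi> ` parcs H" by blast
    next
      fix e assume "e \<in> map_prod ?\<psi> ?\<psi> ` parcs H"
      then obtain u w where uw: "(u, w) \<in> parcs H" "e = (?\<psi> u, ?\<psi> w)" by auto
      have "u \<in> V" using uw in_arcsD1 by (simp add: V_def)
      then obtain h where h: "u = \<phi> h" "h \<in> pverts (HJ' n)" using bij by (auto simp: bij_betw_def)
      have "w \<in> N (\<phi> h)" using uw h by (simp add: N_def)
      then obtain k where k: "w = \<phi> k" "(h, k) \<in> parcs (HJ' n)" using nbr[OF h(2)] by blast
      then show "e \<in> parcs (HJ' n)" using uw(2) h inv arc_verts by auto
    qed
    moreover have "bij_betw ?\<psi> (pverts H) (pverts (HJ' n))" using bij_betw_inv_into[OF bij] by (simp add: V_def)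
    ultimately have "digraph_iso (with_proj H) (with_proj (HJ' n))"
      by (intro digraph_iso_pairI[OF pair_wf_digraph_axioms])
    then show ?thesis using n by blast
  qed
qed

end
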